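(* Let $x_1,\dots,x_n$ be unit vectors spanning a set of $n$ (distinct) complex equiangular lines in $\mathbb{C}^d$ with angle $\alpha>0$ and Gram matrix $G$. Suppose that: (i) the set of lines meets the relative bound, i.e. $$\alpha^2=\frac{n-d}{(n-1)d};$$ (ii) all off-diagonal entries of the matrix $S=\frac{1}{\alpha}(G-I)$ are $r$-th roots of unity, where $r$ is a prime. Then there exists a cyclic $(n,r,c)$-drackn, where $$c=\frac{1}{r}\left((n-2)+\frac{2d-n}{\alpha d}\right).$$
   Context: A set of $n$ complex equiangular lines in $\mathbb{C}^d$ with angle $\alpha$ ($n\ge 2$) is a set of $n$ distinct lines through the origin, spanned by unit vectors $x_1,\dots,x_n\in\mathbb{C}^d$ with $|\langle x_i,x_j\rangle|=\alpha$ for all $i\ne j$. The Gram matrix is the $n\times n$ matrix of inner products of the $x_i$. An $r$-fold cover of $K_n$ is a simple graph on $rn$ vertices whose vertex set is partitioned into $n$ sets of size $r$ (fibres) such that no two vertices in the same fibre are adjacent and the edges between any two distinct fibres form a perfect matching. An $(n,r,c)$-drackn (distance-regular antipodal cover of $K_n$; $n,r\ge 2$, $c\ge 1$) is an $r$-fold cover of $K_n$ that is an antipodal distance-regular graph of diameter $3$ whose antipodal classes are the fibres, in which any two vertices at distance two have exactly $c$ common neighbours. An arc function of index $r$ over $K_n$ is a function $f$ from the arcs (ordered pairs of distinct vertices) of $K_n$ to $\mathrm{Sym}(r)$ with $f(v,u)=f(u,v)^{-1}$; it determines the $r$-fold cover with vertices $(u,i)$, $u\in V(K_n)$, $1\le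 i\le r$, in which the matching from fibre $u$ to fibre $v$ is given by the permutation $f(u,v)$. It is normalized if it is the identity on the arcs of some spanning tree of $K_n$. Every $r$-fold cover is determined by a normalized arc function. $\langle f\rangle$ denotes the permutation group generated by the values of $f$. A cover determined by a normalized arc function $f$ is regular if $\langle f\rangle$ acts regularly on the $r$ points, and cyclic if moreover $\langle f\rangle$ is a cyclic group. *)

theory Defs
  imports
    "HOL-Library.Disjoint_Sets"
    "HOL-Computational_Algebra.Primes"
    "HOL-Algebra.Sym_Groups"
    "HOL-Algebra.Group_Action"
    "HOL-Algebra.Elementary_Groups"
    "Jordan_Normal_Form.Conjugate"
    "Jordan_Normal_Form.Matrix"
    "Graph_Theory.Graph_Theory"
begin

section \<open>Complex equiangular lines\<close>

definition line_of :: "complex vec \<Rightarrow> complex vec set" where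
  "line_of v = {a \<cdot>\<^sub>v v | a. True}"

definition equiangular_lines :: "nat \<Rightarrow> nat \<Rightarrow> real \<Rightarrow> (nat \<Rightarrow> complex vec) \<Rightarrow> bool" where
  "equiangular_lines n d \<alpha> x \<longleftrightarrow>
     2 \<le> n \<and>
     (\<forall>i<n. x i \<in> carrier_vec d \<and> x i \<bullet>c x i = 1) \<and>
     inj_on (\<lambda>i. line_of (x i)) {..<n} \<and>
     (\<forall>i<n. \<forall>j<n. i \<noteq> j \<longrightarrow> cmod (x i \<bullet>c x j) = \<alpha>)"

definition gram_matrix :: "nat \<Rightarrow> (nat \<Rightarrow> complex vec) \<Rightarrow> complex mat" where
  "gram_matrix n x = mat n n (\<lambda>(i, j). x i \<bullet>c x j)"

definition signature_matrix :: "nat \<Rightarrow> real \<Rightarrow> (nat \<Rightarrow> complex vec) \<Rightarrow> complex mat" where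
  "signature_matrix n \<alpha> x = complex_of_real (1 / \<alpha>) \<cdot>\<^sub>m (gram_matrix n x - 1\<^sub>m n)"


section \<open>Antipodal distance-regular graphs\<close>

text \<open>Finite simple graphs are the loopless symmetric digraphs \<open>pair_graph\<close>: an edge is
  represented by both of its arcs.\<close>

definition gdist :: "'v pair_pre_digraph \<Rightarrow> 'v \<Rightarrow> 'v \<Rightarrow> ereal" where
  "gdist X u v = wf_digraph.\<mu> (with_proj X) (\<lambda>_. 1) u v"

definition graph_diameter :: "'v pair_pre_digraph \<Rightarrow> ereal" where
  "graph_diameter X = (SUP u\<in>pverts X. SUP v\<in>pverts X. gdist X u v)"

text \<open>For \<open>i = 0\<close> the set counted by \<open>c 0\<close> is empty, as \<open>real i - 1\<close> is not truncated.\<close>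

definition distance_regular :: "'v pair_pre_digraph \<Rightarrow> bool" where
  "distance_regular X \<longleftrightarrow>
     pair_graph X \<and> Digraph_Component.connected (with_proj X) \<and>
     (\<exists>b c :: nat \<Rightarrow> nat. \<forall>i. \<forall>u\<in>pverts X. \<forall>v\<in>pverts X. gdist X u v = ereal (real i) \<longrightarrow>
        card {w \<in> pverts X. (v, w) \<in> parcs X \<and> gdist X u w = ereal (real i + 1)} = b i \<and>
        card {w \<in> pverts X. (v, w) \<in> parcs X \<and> gdist X u w = ereal (real i - 1)} = c i)"

definition antipodal_rel :: "'v pair_pre_digraph \<Rightarrow> ('v \<times> 'v) set" where
  "antipodal_rel X = {(u, v) \<in> pverts X \<times> pverts X. u = v \<or> gdist X u v = graph_diameter X}"

definition antipodal :: "'v pair_pre_digraph \<Rightarrow> bool" where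
  "antipodal X \<longleftrightarrow> equiv (pverts X) (antipodal_rel X)"

definition antipodal_classes :: "'v pair_pre_digraph \<Rightarrow> 'v set set" where
  "antipodal_classes X = pverts X // antipodal_rel X"


section \<open>Covers of complete graphs\<close>

text \<open>\<open>F\<close> is the set of fibres. The last condition is imposed on the ordered pairs \<open>(A, B)\<close>
  and \<open>(B, A)\<close>, hence says that the edges between \<open>A\<close> and \<open>B\<close> form a perfect matching.\<close>

definition cover_of_complete ::
  "nat \<Rightarrow> nat \<Rightarrow> 'v pair_pre_digraph \<Rightarrow> 'v set set \<Rightarrow> bool" where
  "cover_of_complete n r X F \<longleftrightarrow>
     pair_graph X \<and> card (pverts X) = r * n \<and>
     partition_on (pverts X) F \<and> card F = n \<and> (\<forall>A\<in>F. card A = r) \<and>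
     (\<forall>A\<in>F. \<forall>u\<in>A. \<forall>v\<in>A. (u, v) \<notin> parcs X) \<and>
     (\<forall>A\<in>F. \<forall>B\<in>F. A \<noteq> B \<longrightarrow> (\<forall>u\<in>A. \<exists>!v. v \<in> B \<and> (u, v) \<in> parcs X))"

definition drackn ::
  "nat \<Rightarrow> nat \<Rightarrow> nat \<Rightarrow> 'v pair_pre_digraph \<Rightarrow> 'v set set \<Rightarrow> bool" where
  "drackn n r c X F \<longleftrightarrow>
     2 \<le> n \<and> 2 \<le> r \<and> 1 \<le> c \<and>
     cover_of_complete n r X F \<and>
     distance_regular X \<and> graph_diameter X = 3 \<and>
     antipodal X \<and> antipodal_classes X = F \<and>
     (\<forall>u\<in>pverts X. \<forall>v\<in>pverts X. gdist X u v = 2 \<longrightarrow>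
        card {w \<in> pverts X. (u, w) \<in> parcs X \<and> (w, v) \<in> parcs X} = c)"


section \<open>Arc functions\<close>

text \<open>The vertices of the complete graph are labelled \<open>0, \<dots>, n - 1\<close>; the points permuted are
  \<open>1, \<dots>, r\<close>, as in \<open>sym_group r\<close>.\<close>

definition complete_graph :: "nat \<Rightarrow> nat pair_pre_digraph" where
  "complete_graph n = \<lparr>pverts = {..<n}, parcs = {(u, v). u < n \<and> v < n \<and> u \<noteq> v}\<rparr>"

definition arc_function :: "nat \<Rightarrow> nat \<Rightarrow> (nat \<Rightarrow> nat \<Rightarrow> nat \<Rightarrow> nat) \<Rightarrow> bool" where
  "arc_function n r f \<longleftrightarrow>
     (\<forall>(u, v)\<in>parcs (complete_graph n).
        f u v \<in> carrier (sym_group r) \<and> f v u = inv\<^bsub>sym_group r\<^esub> (f u v))"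

text \<open>The library's \<open>forest\<close> (and so \<open>tree\<close> and \<open>spanning_tree\<close>) forbids all directed cycles,
  including the closed walk \<open>a, b, a\<close> along a single edge of a symmetric digraph. For an undirected
  tree only cycles of length at least 3 are excluded.\<close>

definition undirected_tree :: "'v pair_pre_digraph \<Rightarrow> bool" where
  "undirected_tree T \<longleftrightarrow>
     pair_graph T \<and> Digraph_Component.connected (with_proj T) \<and>
     \<not> (\<exists>p. pre_digraph.cycle (with_proj T) p \<and> 3 \<le> length p)"

definition normalized_arc_function :: "nat \<Rightarrow> nat \<Rightarrow> (nat \<Rightarrow> nat \<Rightarrow> nat \<Rightarrow> nat) \<Rightarrow> bool" where
  "normalized_arc_function n r f \<longleftrightarrow>
     arc_function n r f \<and>
     (\<exists>T. undirected_tree T \<and> spanning (with_proj T) (with_proj (complete_graph n)) \<and>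
        (\<forall>(u, v)\<in>parcs T. f u v = id))"

definition arc_group :: "nat \<Rightarrow> nat \<Rightarrow> (nat \<Rightarrow> nat \<Rightarrow> nat \<Rightarrow> nat) \<Rightarrow> (nat \<Rightarrow> nat) monoid" where
  "arc_group n r f =
     subgroup_generated (sym_group r) {f u v | u v. (u, v) \<in> parcs (complete_graph n)}"

definition acts_regularly :: "(nat \<Rightarrow> nat) monoid \<Rightarrow> nat set \<Rightarrow> bool" where
  "acts_regularly H E \<longleftrightarrow>
     (\<forall>i\<in>E. Group_Action.orbit H (\<lambda>g. g) i = E \<and> stabilizer H (\<lambda>g. g) i = {\<one>\<^bsub>H\<^esub>})"

definition arc_cover :: "nat \<Rightarrow> nat \<Rightarrow> (nat \<Rightarrow> nat \<Rightarrow> nat \<Rightarrow> nat) \<Rightarrow> (nat \<times> nat) pair_pre_digraph"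
  where
  "arc_cover n r f =
     \<lparr>pverts = {..<n} \<times> {1..r},
      parcs = {((u, i), (v, j)). (u, v) \<in> parcs (complete_graph n) \<and>
                 i \<in> {1..r} \<and> j \<in> {1..r} \<and> f u v i = j}\<rparr>"

definition arc_cover_fibres :: "nat \<Rightarrow> nat \<Rightarrow> (nat \<times> nat) set set" where
  "arc_cover_fibres n r = {{u} \<times> {1..r} | u. u < n}"

definition cyclic_cover ::
  "nat \<Rightarrow> nat \<Rightarrow> (nat \<times> nat) pair_pre_digraph \<Rightarrow> (nat \<times> nat) set set \<Rightarrow> bool" where
  "cyclic_cover n r X F \<longleftrightarrow>
     (\<exists>f. normalized_arc_function n r f \<and>
        X = arc_cover n r f \<and> F = arc_cover_fibres n r \<and>
        acts_regularly (arc_group n r f) {1..r} \<and> cyclic_group (arc_group n r f))"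

end

(* Meeting the relative bound forces S^2 = (n - 1) I + a S with a = (n - 2d) / (alpha d). After
   rescaling the lines, S_ij = zeta^e_ij with zeta a primitive r-th root of unity and e_0j = 0; let
   N_t(i, j) be the number of k with e_ik + e_kj = e_ij + t modulo r. The equation for S reads
   sum_t N_t zeta^t = a. If a is rational, irreducibility of the r-th cyclotomic polynomial gives
   r N_t = n - 2 - a for all t /= 0. The number a^2 is always rational, and an irrational a is
   excluded by a comparison of r-adic valuations. Hence in the Z_r-cover with arc function e two
   nonadjacent vertices in different fibres have exactly c = (n - 2 - a) / r common neighbours, and
   adjacent ones have n - 2 - (r - 1) c, which makes the cover an antipodal distance-regular graph
   of diameter 3. Finally c = 0 would give alpha = 1, contradicting that the lines are distinct. *)
theory Submission
  imports
    Defs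
    "HOL-Computational_Algebra.Polynomial_Factorial"
    "HOL-Number_Theory.Cong"
    "Jordan_Normal_Form.Char_Poly"
begin

section \<open>Integer combinations of roots of unity of prime order\<close>

text \<open>Irreducibility alone does not exclude an irrational a: for odd r the field of r-th roots
  of unity contains a square root of r or of -r, as a quadratic Gauss sum, and if a were a multiple
  of it, N_t - N_0 would follow the quadratic character of t. The missing information comes from the
  eigenvalues of S, which are (n - d) / (\<alpha> d) and -1 / \<alpha>. Their sum is a and their
  difference is n / (\<alpha> d), so difference and sum have the rational ratio n / (n - 2d) unless
  a = 0. Being roots of t^2 - a t - (n - 1), they also differ by the square root of a^2 + 4 (n - 1).
  Hence (a^2 + 4 (n - 1)) (n - 2d)^2 = a^2 n^2. The eigenvalues themselves are not computed in the
  proof; only this identity is.\<close>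

lemma root_power_eq_iff:
  fixes w :: complex
  assumes "prime r" "w ^ r = 1" "w \<noteq> 1"
  shows "w ^ k = 1 \<longleftrightarrow> r dvd k"
proof
  assume "r dvd k"
  then show "w ^ k = 1" using assms by (auto simp: power_mult)
next
  assume k: "w ^ k = 1"
  show "r dvd k"
  proof (rule ccontr)
    assume "\<not> r dvd k"
    then have "coprime k r"
      using assms(1) prime_imp_coprime coprime_commute by blast
    moreover have "k \<noteq> 0" using \<open>\<not> r dvd k\<close> by (intro notI) simp
    \<comment> \<open>The exponent \<open>x\<close> inverts \<open>k\<close> modulo r, so
      \<open>w ^ k = 1\<close> would force \<open>w = 1\<close>.\<close>
    ultimately obtain x y where "k * x = Suc (r * y)"
      using coprime_bezout_strong[of k r] assms(1) prime_nat_iff by (metis One_nat_def add.commute plus_1_eq_Suc bezout_nat coprime_iff_gcd_eq_1)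
    then have "w ^ (k * x) = w * (w ^ r) ^ y" by (simp add: power_mult)
    then show False using k assms by (simp add: power_mult)
  qed
qed

text \<open>Orthogonality of characters: if r does not divide \<open>k\<close>, then
  \<open>w ^ k\<close> is again a nontrivial r-th root of unity and the geometric series
  vanishes.\<close>

lemma sum_root_powers:
  fixes w :: complex
  assumes "prime r" "w ^ r = 1" "w \<noteq> 1"
  shows "(\<Sum>t<r. w ^ (t * k)) = (if r dvd k then of_nat r else 0)"
proof (cases "r dvd k")
  case True
  then have "w ^ (t * k) = 1" for t
    using root_power_eq_iff[OF assms] by simp
  then show ?thesis using True by simp
next
  case False
  then have "w ^ k \<noteq> 1" using root_power_eq_iff[OF assms] by simp
  moreover have "(w ^ k) ^ r = 1"
    using assms by (metis mult.commute power_mult power_one)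
  ultimately have "(\<Sum>t<r. (w ^ k) ^ t) = 0" by (simp add: sum_gp_strict)
  moreover have "(w ^ k) ^ t = w ^ (t * k)" for t by (simp add: power_mult[symmetric] mult.commute)
  ultimately show ?thesis using False by simp
qed

text \<open>Summing over all r-th roots of unity filters out the exponents not divisible by r. What
  matters later is that the value is r times an integer.\<close>

lemma sum_poly_root_powers:
  fixes w :: complex and F :: "int poly"
  assumes "prime r" "w ^ r = 1" "w \<noteq> 1"
  shows "(\<Sum>t<r. poly (map_poly of_int F) (w ^ t)) =
    of_int (int r * (\<Sum>k | k \<le> degree F \<and> r dvd k. coeff F k))"
proof -
  have "(\<Sum>t<r. poly (map_poly of_int F) (w ^ t)) =
      (\<Sum>t<r. \<Sum>k\<le>degree F. of_int (coeff F k) * w ^ (t * k))"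
    by (simp add: poly_altdef power_mult)
  also have "\<dots> = (\<Sum>k\<le>degree F. of_int (coeff F k) * (\<Sum>t<r. w ^ (t * k)))"
    by (subst sum.swap) (simp add: sum_distrib_left)
  also have "\<dots> = (\<Sum>k\<le>degree F. if r dvd k then of_int (int r * coeff F k) else 0)"
    unfolding sum_root_powers[OF assms] by (intro sum.cong) auto
  also have "\<dots> = (\<Sum>k | k \<le> degree F \<and> r dvd k. of_int (int r * coeff F k))"
    by (subst sum.inter_filter[symmetric]) auto
  finally show ?thesis by (simp add: sum_distrib_left)
qed

lemma poly_of_int_pcompose_monom:
  "poly (map_poly of_int (pcompose P (monom 1 s))) (x :: complex) = poly (map_poly of_int P) (x ^ s)"
  by (simp add: of_int_poly_hom.map_poly_pcompose poly_pcompose poly_monom of_int_hom.map_poly_pcompose)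

text \<open>\<open>F = \<Prod>\<^sub>s P(X\<^sup>s)\<close> vanishes at every nontrivial \<open>r\<close>-th root of unity, so \<open>P(1)\<^bsup>r-1\<^esup> = F(1)\<close>
  is the sum of \<open>F\<close> over all \<open>r\<close>-th roots of unity, a multiple of \<open>r\<close>.\<close>

lemma poly_root_of_unity_imp_dvd:
  fixes w :: complex and P :: "int poly"
  assumes "prime r" "w ^ r = 1" "w \<noteq> 1" "poly (map_poly of_int P) w = 0"
  shows "int r dvd poly P 1"
proof -
  define F where "F = (\<Prod>s\<in>{1..<r}. pcompose P (monom 1 s))"
  have F: "poly (map_poly of_int F) x = (\<Prod>s\<in>{1..<r}. poly (map_poly of_int P) (x ^ s))" for x :: complex
    unfolding F_def by (simp add: of_int_poly_hom.hom_prod poly_prod poly_of_int_pcompose_monom)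
  have zero: "poly (map_poly of_int F) (w ^ t) = 0" if "t \<in> {1..<r}" for t
  proof -
    have "\<not> r dvd t" using that by (auto dest: dvd_imp_le)
    then have "coprime t r" using assms(1) prime_imp_coprime coprime_commute by blast
    \<comment> \<open>As \<open>s\<close> inverts \<open>t\<close> modulo r, the factor of
      \<open>F\<close> with index \<open>s mod r\<close> takes at \<open>w ^ t\<close> the value
      P(w) = 0.\<close>
    then obtain s where s: "[t * s = 1] (mod r)" using cong_solve_coprime_nat by auto
    let ?s = "s mod r"
    have r2: "r \<ge> 2" using assms(1) prime_ge_2_nat by blast
    have s': "t * ?s mod r = 1" using s r2 unfolding cong_def by (simp add: mod_mult_right_eq)
    then have "?s \<noteq> 0" by (intro notI) simp
    then have mem: "?s \<in> {1..<r}" using r2 by simp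
    have "t * ?s = r * (t * ?s div r) + 1" using s' by (metis mult_div_mod_eq)
    then have "w ^ (t * ?s) = (w ^ r) ^ (t * ?s div r) * w" by (metis power_add power_mult power_one_right)
    then have "(w ^ t) ^ ?s = w" using assms(2) by (simp add: power_mult)
    then have "poly (map_poly of_int P) ((w ^ t) ^ ?s) = 0" using assms(4) by simp
    then show ?thesis unfolding F using mem by (intro prod_zero) auto
  qed
  have split: "{..<r} = insert 0 {1..<r}" using assms(1) prime_gt_0_nat by force
  have "(\<Sum>t<r. poly (map_poly of_int F) (w ^ t)) = poly (map_poly of_int F) 1"
    unfolding split using zero by simp
  also have "\<dots> = of_int (poly P 1) ^ (r - 1)" unfolding F by simp
  finally have "of_int (poly P 1 ^ (r - 1)) =
      (of_int (int r * (\<Sum>k | k \<le> degree F \<and> r dvd k. coeff F k)) :: complex)"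
    unfolding sum_poly_root_powers[OF assms(1-3)] by simp
  then have "int r dvd poly P 1 ^ (r - 1)" unfolding of_int_eq_iff by simp
  then show ?thesis using assms(1) prime_dvd_power by (metis prime_nat_int_transfer)
qed

text \<open>The minimal polynomial \<open>Q\<close> of \<open>w\<close> divides \<open>\<Phi> = 1 + X + \<dots> + X\<^bsup>r-1\<^esup>\<close>. If a conjugate of \<open>w\<close> were a root
  of the cofactor \<open>R\<close>, then \<open>r\<close> would divide both \<open>Q(1)\<close> and \<open>R(1)\<close>, while \<open>\<Phi>(1) = r\<close>.\<close>

lemma poly_root_of_unity_conjugate:
  fixes w :: complex and P :: "int poly"
  assumes "prime r" "w ^ r = 1" "w \<noteq> 1" "poly (map_poly of_int P) w = 0" "\<not> r dvd s"
  shows "poly (map_poly of_int P) (w ^ s) = 0"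
proof -
  let ?e = "\<lambda>P :: int poly. poly (map_poly of_int P) :: complex \<Rightarrow> complex"
  define \<Phi> :: "int poly" where "\<Phi> = (\<Sum>k<r. monom 1 k)"
  have e\<Phi>: "?e \<Phi> x = (\<Sum>k<r. x ^ k)" for x
    unfolding \<Phi>_def by (simp add: of_int_poly_hom.hom_sum poly_sum poly_monom)
  have \<Phi>0: "?e \<Phi> (w ^ t) = 0" if "\<not> r dvd t" for t
    unfolding e\<Phi> using sum_root_powers[OF assms(1-3), of t] that
    by (simp add: power_mult[symmetric] mult.commute)
  have \<Phi>1: "poly \<Phi> 1 = int r" unfolding \<Phi>_def by (simp add: poly_sum poly_monom)
  have r0: "r > 1" using assms(1) prime_gt_1_nat by blast
  then have "\<not> r dvd 1" by simp
  then have \<Phi>w: "?e \<Phi> w = 0" using \<Phi>0[of 1] by simp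
  have \<Phi>n: "\<Phi> \<noteq> 0" using \<Phi>1 r0 by auto
  define good where "good = (\<lambda>Q. Q \<noteq> 0 \<and> ?e Q w = 0)"
  \<comment> \<open>\<open>Q0\<close> has least degree among the nonzero integer polynomials
    vanishing at \<open>w\<close>. Its primitive part is taken so that divisibility over the
    fraction field descends to integer polynomials by Gauss's lemma; pseudo-division replaces
    division with remainder.\<close>
  obtain Q0 where Q0: "good Q0" "\<And>Q. good Q \<Longrightarrow> degree Q0 \<le> degree Q"
    using ex_has_least_nat[of good \<Phi> degree] \<Phi>w \<Phi>n unfolding good_def by blast
  define Q where "Q = primitive_part Q0"
  have "Q0 = smult (content Q0) Q" unfolding Q_def by simp
  then have "?e Q0 w = of_int (content Q0) * ?e Q w"
    by (metis of_int_hom.map_poly_hom_smult poly_smult)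
  then have Q: "Q \<noteq> 0" "?e Q w = 0" "content Q = 1" "degree Q = degree Q0"
    using Q0(1) unfolding good_def Q_def by auto
  have Qdvd: "Q dvd B" if B: "?e B w = 0" for B
  proof -
    obtain a q where aq: "a \<noteq> 0" "smult a B = Q * q + pseudo_mod B Q"
      using pseudo_mod(1)[OF Q(1)] by blast
    have "?e (smult a B) w = ?e (Q * q + pseudo_mod B Q) w" using aq by simp
    then have "?e (pseudo_mod B Q) w = 0"
      using B Q(2) by (simp add: of_int_poly_hom.hom_mult of_int_poly_hom.hom_add of_int_hom.map_poly_hom_smult)
    then have "pseudo_mod B Q = 0"
      using pseudo_mod(2)[OF Q(1), of B] Q0(2)[of "pseudo_mod B Q"] Q(4) unfolding good_def
      by (metis leD)
    then have "Q dvd smult a B" using aq by simp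
    then have "fract_poly Q dvd smult (to_fract a) (fract_poly B)"
      by (metis fract_poly_dvd fract_poly_smult)
    then have "fract_poly Q dvd fract_poly B" using aq(1) by (simp add: dvd_smult_iff)
    then show ?thesis using Q(3) by (rule fract_poly_dvdD)
  qed
  obtain R where R: "\<Phi> = Q * R" using Qdvd[OF \<Phi>w] by blast
  have "?e Q (w ^ s) = 0"
  proof (rule ccontr)
    assume "?e Q (w ^ s) \<noteq> 0"
    then have Rs: "?e R (w ^ s) = 0"
      using \<Phi>0[OF assms(5)] unfolding R by (simp add: of_int_poly_hom.hom_mult of_int_poly_hom.hom_add)
    have "w ^ s \<noteq> 1" using root_power_eq_iff[OF assms(1-3)] assms(5) by simp
    moreover have "(w ^ s) ^ r = 1" using assms(2) by (metis mult.commute power_mult power_one)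
    ultimately have "int r dvd poly R 1"
      using poly_root_of_unity_imp_dvd[OF assms(1) _ _ Rs] by simp
    moreover have "int r dvd poly Q 1" using poly_root_of_unity_imp_dvd[OF assms(1-3) Q(2)] .
    ultimately have "int r * int r dvd poly \<Phi> 1" unfolding R by (simp add: mult_dvd_mono)
    then show False unfolding \<Phi>1 using r0 by simp
  qed
  then show ?thesis using Qdvd[OF assms(4)] by (auto simp: dvd_def of_int_poly_hom.hom_mult)
qed

section \<open>Coefficients of a sum of roots of unity whose square is rational\<close>

lemma root_of_unity_mult_cnj:
  fixes z :: complex
  assumes "0 < r" "z ^ r = 1"
  shows "z * cnj z = 1"
proof -
  have "cmod z ^ r = 1" using assms(2) by (metis norm_one norm_power)
  then have "cmod z = 1" using assms(1) power_eq_imp_eq_base[of "cmod z" r 1] by simp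
  then show ?thesis by (simp add: complex_norm_square[symmetric])
qed

text \<open>Here \<open>r - t\<close> plays the role of -t, which keeps all exponents natural
  numbers; the sum over \<open>s\<close> singles out the index \<open>j = t\<close>.\<close>

lemma fourier_inversion_root:
  fixes w :: complex and N :: "nat \<Rightarrow> nat"
  assumes "prime r" "w ^ r = 1" "w \<noteq> 1" "t < r"
  shows "(\<Sum>s<r. (\<Sum>j<r. of_nat (N j) * w ^ (s * j)) * w ^ (s * (r - t))) = of_nat (r * N t)"
proof -
  have iff: "r dvd j + (r - t) \<longleftrightarrow> j = t" if "j < r" for j
  proof
    assume "r dvd j + (r - t)"
    then obtain q where q: "j + (r - t) = r * q" by blast
    have "r * q < r * 2" using q that assms(4) by linarith
    then have "q < 2" by simp
    moreover have "q \<noteq> 0" using q assms(4) by (intro notI) simp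
    ultimately have "q = 1" by simp
    then show "j = t" using q assms(4) by simp
  qed (use assms(4) in simp)
  have "(\<Sum>s<r. (\<Sum>j<r. of_nat (N j) * w ^ (s * j)) * w ^ (s * (r - t))) =
      (\<Sum>s<r. \<Sum>j<r. of_nat (N j) * w ^ (s * (j + (r - t))))"
    by (simp add: sum_distrib_right power_add distrib_left mult.assoc)
  also have "\<dots> = (\<Sum>j<r. of_nat (N j) * (\<Sum>s<r. w ^ (s * (j + (r - t)))))"
    by (subst sum.swap) (simp add: sum_distrib_left)
  also have "\<dots> = (\<Sum>j<r. if j = t then of_nat (r * N t) else 0)"
    unfolding sum_root_powers[OF assms(1-3)] using iff by (intro sum.cong) auto
  also have "\<dots> = of_nat (r * N t)" using assms(4) by simp
  finally show ?thesis .
qed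

text \<open>The two sides would have \<open>r\<close>-adic valuations of different parity.\<close>

lemma odd_prime_discriminant_neq:
  fixes M m k l :: int
  assumes "prime r" "r \<noteq> 2" "int r dvd m" "M \<noteq> 0" "l \<noteq> 0"
  shows "(int r * M\<^sup>2 + 4 * (m + 1)) * k\<^sup>2 \<noteq> int r * M\<^sup>2 * l\<^sup>2"
proof
  assume eq: "(int r * M\<^sup>2 + 4 * (m + 1)) * k\<^sup>2 = int r * M\<^sup>2 * l\<^sup>2"
  have p: "prime (int r)" using assms(1) by simp
  then have pe: "prime_elem (int r)" by simp
  have "\<not> int r dvd 4"
  proof
    assume "int r dvd 4"
    then have "int r dvd 2 ^ 2" by simp
    then have "int r dvd 2" using p prime_dvd_power by blast
    then show False using assms(1,2) primes_dvd_imp_eq[of r 2] by (metis of_nat_dvd_iff of_nat_numeral two_is_prime_nat)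
  qed
  \<comment> \<open>The factor is congruent to 4 modulo r because r divides \<open>m\<close>. So the
    valuation of the left side is that of the square of \<open>k\<close>, while the right side
    carries one additional factor r.\<close>
  then have ndvd: "\<not> int r dvd int r * M\<^sup>2 + 4 * (m + 1)"
    using assms(3) by (auto simp: dvd_add_right_iff distrib_left dvd_add_left_iff)
  have nz: "int r * M\<^sup>2 + 4 * (m + 1) \<noteq> 0" using ndvd by (intro notI) simp
  have k: "k \<noteq> 0" using eq assms(1,4,5) by (auto simp: prime_gt_0_nat)
  have "multiplicity (int r) (X * k\<^sup>2) = 2 * multiplicity (int r) k" if "X \<noteq> 0" "\<not> int r dvd X" for X
    using that k by (simp add: prime_elem_multiplicity_mult_distrib[OF pe]
      prime_elem_multiplicity_power_distrib[OF pe] not_dvd_imp_multiplicity_0)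
  from this[OF nz ndvd]
  have "multiplicity (int r) ((int r * M\<^sup>2 + 4 * (m + 1)) * k\<^sup>2) = 2 * multiplicity (int r) k" .
  moreover have "multiplicity (int r) (int r * M\<^sup>2 * l\<^sup>2) =
      Suc (2 * multiplicity (int r) M + 2 * multiplicity (int r) l)"
    using assms(4,5) pe by (simp add: prime_elem_multiplicity_mult_distrib[OF pe]
      prime_elem_multiplicity_power_distrib[OF pe])
  ultimately have "2 * multiplicity (int r) k = Suc (2 * multiplicity (int r) M + 2 * multiplicity (int r) l)"
    using eq by simp
  then show False by presburger
qed

text \<open>As \<open>a\<^sup>2\<close> is rational, every conjugate of \<open>a\<close> is \<open>\<epsilon>\<^sub>s a\<close> with a sign \<open>\<epsilon>\<^sub>s\<close>. If all signs are
  positive, Fourier inversion gives the coefficients. Otherwise \<open>\<epsilon>\<close> is a quadratic character and \<open>a\<close> is an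
  integer multiple of its Gauss sum, so \<open>a\<^sup>2 = r M\<^sup>2\<close> with \<open>M\<close> an integer, and \<open>r\<close> divides \<open>m\<close>; this
  contradicts \<open>disc\<close>, which says that \<open>(a\<^sup>2 + 4 (m + 1)) / a\<^sup>2\<close> is the square of a rational number.\<close>

lemma root_sum_coeffs_equal:
  fixes w :: complex and N :: "nat \<Rightarrow> nat" and a :: real and u v k l :: int
  assumes r: "prime r" and w: "w ^ r = 1" "w \<noteq> 1"
    and val: "(\<Sum>t<r. of_nat (N t) * w ^ t) = of_real a"
    and m: "(\<Sum>t<r. N t) = m"
    and rat: "a\<^sup>2 * of_int v = of_int u" "v \<noteq> 0"
    and disc: "(a\<^sup>2 + 4 * (real m + 1)) * of_int (k\<^sup>2) = a\<^sup>2 * of_int (l\<^sup>2)" "l \<noteq> 0"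
    and t: "0 < t" "t < r"
  shows "real r * real (N t) = real m - a"
proof -
  let ?e = "\<lambda>P :: int poly. poly (map_poly of_int P) :: complex \<Rightarrow> complex"
  define P :: "int poly" where "P = (\<Sum>t<r. monom (int (N t)) t)"
  define E where "E = ?e P"
  have E: "E x = (\<Sum>t<r. of_nat (N t) * x ^ t)" for x
    unfolding E_def P_def by (simp add: of_int_poly_hom.hom_sum poly_sum poly_monom)
  have E1: "E 1 = of_nat m" unfolding E m[symmetric] by simp
  have Ew: "E w = of_real a" unfolding E by (rule val)
  have r1: "r > 1" using r prime_gt_1_nat by blast
  have nd: "\<not> r dvd s" if "s \<in> {1..<r}" for s using that by (auto dest: dvd_imp_le)
  have split: "{..<r} = insert 0 {1..<r}" using r1 by force
  have sq: "(E (w ^ s))\<^sup>2 = (of_real a)\<^sup>2" if "\<not> r dvd s" for s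
  proof -
    have "complex_of_real (a\<^sup>2 * of_int v) = of_real (of_int u)" using rat(1) by simp
    then have uv: "(complex_of_real a)\<^sup>2 * of_int v = of_int u" by simp
    have const: "?e [:u:] x = of_int u" for x
      by (cases "u = 0") (simp_all add: map_poly_pCons)
    \<comment> \<open>The integer polynomial v P^2 - u vanishes at \<open>w\<close>, hence at every
      conjugate of \<open>w\<close>.\<close>
    have ev: "?e (smult v (P ^ 2) - [:u:]) x = of_int v * (E x)\<^sup>2 - of_int u" for x
      unfolding E_def
      by (simp add: of_int_poly_hom.hom_minus of_int_hom.map_poly_hom_smult of_int_poly_hom.hom_power const)
    have "?e (smult v (P ^ 2) - [:u:]) w = 0" unfolding ev Ew using uv by (simp add: mult.commute)
    from poly_root_of_unity_conjugate[OF r w this that]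
    have "of_int v * (E (w ^ s))\<^sup>2 = of_int u" unfolding ev by simp
    with uv have "of_int v * (E (w ^ s))\<^sup>2 = of_int v * (complex_of_real a)\<^sup>2" by (simp add: mult.commute)
    then show ?thesis using rat(2) by simp
  qed
  define \<epsilon> :: "nat \<Rightarrow> int" where "\<epsilon> s = (if E (w ^ s) = of_real a then 1 else -1)" for s
  have \<epsilon>: "E (w ^ s) = of_int (\<epsilon> s) * of_real a" if "\<not> r dvd s" for s
    using sq[OF that] unfolding \<epsilon>_def by (auto simp: power2_eq_iff)
  have \<epsilon>\<epsilon>: "\<epsilon> s * \<epsilon> s = 1" for s unfolding \<epsilon>_def by simp
  have mult: "E (w ^ (s * j)) = of_int (\<epsilon> s) * E (w ^ j)" if "\<not> r dvd s" "\<not> r dvd j" for s j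
  proof -
    \<comment> \<open>The same transfer, applied to P(X^s) minus \<open>\<epsilon> s\<close> times
      P, makes the sign \<open>\<epsilon> s\<close> valid at every conjugate and not only at
      \<open>w\<close>.\<close>
    have ev: "?e (pcompose P (monom 1 s) - smult (\<epsilon> s) P) x = E (x ^ s) - of_int (\<epsilon> s) * E x" for x
      unfolding E_def
      by (simp add: of_int_poly_hom.hom_minus of_int_hom.map_poly_hom_smult poly_of_int_pcompose_monom)
    have "?e (pcompose P (monom 1 s) - smult (\<epsilon> s) P) w = 0"
      unfolding ev using \<epsilon>[OF that(1)] Ew by simp
    from poly_root_of_unity_conjugate[OF r w this that(2)] show ?thesis
      unfolding ev by (simp add: power_mult[symmetric] mult.commute)
  qed
  have inv: "of_nat (r * N j) = of_nat m + (\<Sum>s\<in>{1..<r}. E (z ^ s) * z ^ (s * (r - j)))"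
    if "z ^ r = 1" "z \<noteq> 1" "j < r" for z j
  proof -
    have "(\<Sum>s<r. E (z ^ s) * z ^ (s * (r - j))) = of_nat (r * N j)"
      using fourier_inversion_root[OF r that, of N] by (simp add: E power_mult)
    then show ?thesis unfolding split using E1 by simp
  qed
  have prim: "(w ^ s) ^ r = 1" "w ^ s \<noteq> 1" if "\<not> r dvd s" for s
    using w that root_power_eq_iff[OF r w] by (simp_all add: power_mult[symmetric] mult.commute)
  show ?thesis
  proof (cases "\<forall>s\<in>{1..<r}. E (w ^ s) = of_real a")
    case True
    have "\<not> r dvd (r - t)" using t by (auto dest: dvd_imp_le)
    then have "1 + (\<Sum>s\<in>{1..<r}. w ^ (s * (r - t))) = 0"
      using sum_root_powers[OF r w, of "r - t"] unfolding split by simp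
    then have "(\<Sum>s\<in>{1..<r}. w ^ (s * (r - t))) = -1" by (simp only: add_eq_0_iff)
    then have "of_nat (r * N t) = (of_real (real m - a) :: complex)"
      using inv[OF w t(2)] True by (simp add: sum_distrib_left[symmetric])
    then have "complex_of_real (real r * real (N t)) = of_real (real m - a)" by simp
    then show ?thesis by (simp only: of_real_eq_iff)
  next
    case False
    then obtain s0 where s0: "s0 \<in> {1..<r}" "E (w ^ s0) \<noteq> of_real a" by blast
    have a0: "a \<noteq> 0" using s0 \<epsilon>[OF nd[OF s0(1)]] by auto
    have es0: "\<epsilon> s0 = -1" using s0 unfolding \<epsilon>_def by simp
    \<comment> \<open>The coefficient \<open>N 0\<close> is computed both with \<open>w\<close> and
      with \<open>w ^ s0\<close>. The two sums are negatives of each other, so they vanish and r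
      divides \<open>m\<close>.\<close>
    have "of_nat (r * N 0) = of_nat m + (\<Sum>s\<in>{1..<r}. E (w ^ s))"
      using inv[OF w, of 0] r1 w by (simp add: power_mult mult.commute[of _ r])
    moreover have "of_nat (r * N 0) = of_nat m + (\<Sum>s\<in>{1..<r}. E ((w ^ s0) ^ s))"
      using inv[OF prim[OF nd[OF s0(1)]], of 0] r1 prim(1)[OF nd[OF s0(1)]] by (simp add: power_mult mult.commute[of _ r])
    moreover have "(\<Sum>s\<in>{1..<r}. E ((w ^ s0) ^ s)) = (\<Sum>s\<in>{1..<r}. - E (w ^ s))"
    proof (rule sum.cong)
      fix s assume "s \<in> {1..<r}"
      then show "E ((w ^ s0) ^ s) = - E (w ^ s)"
        using mult[OF nd[OF s0(1)] nd, of s] es0 by (simp add: power_mult)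
    qed simp
    ultimately have sum0: "(\<Sum>s\<in>{1..<r}. E (w ^ s)) = 0" and rN0: "of_nat (r * N 0) = (of_nat m :: complex)"
      by (simp_all add: sum_negf)
    have m0: "m = r * N 0" using rN0 by (metis of_nat_eq_iff)
    \<comment> \<open>For r = 2 the vanishing sum would consist of the single term a.\<close>
    have "r \<noteq> 2"
    proof
      assume "r = 2"
      then have "{1..<r} = {1}" by auto
      then show False using sum0 Ew a0 by simp
    qed
    define M where "M j = int (N j) - int (N 0)" for j
    \<comment> \<open>The Gauss sum of the sign character \<open>\<epsilon>\<close>.\<close>
    define g where "g = (\<Sum>s\<in>{1..<r}. of_int (\<epsilon> s) * w ^ s)"
    have cw: "w * cnj w = 1" using root_of_unity_mult_cnj[OF _ w(1)] r1 by simp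
    have cnjw: "cnj w ^ s = w ^ (s * (r - 1))" for s
    proof -
      have "w ^ (s * (r - 1)) * w ^ s = (w ^ r) ^ s"
        using r1 by (simp add: power_add[symmetric] power_mult[symmetric] algebra_simps)
      then have "w ^ (s * (r - 1)) * w ^ s = 1" using w by simp
      then have "w ^ (s * (r - 1)) * (w * cnj w) ^ s = cnj w ^ s"
        by (metis mult.assoc mult.left_neutral power_mult_distrib)
      then show ?thesis using cw by simp
    qed
    have rM1: "of_int (int r * M 1) = of_real a * cnj g"
    proof -
      have "of_nat (r * N 1) = of_nat m + (\<Sum>s\<in>{1..<r}. E (w ^ s) * w ^ (s * (r - 1)))"
        by (rule inv[OF w r1])
      also have "(\<Sum>s\<in>{1..<r}. E (w ^ s) * w ^ (s * (r - 1))) = of_real a * cnj g"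
        unfolding g_def by (simp add: sum_distrib_left cnjw \<epsilon>[OF nd] mult_ac)
      finally show ?thesis unfolding M_def m0 by (simp add: algebra_simps)
    qed
    \<comment> \<open>Inversion at \<open>w ^ j\<close> instead of \<open>w\<close> multiplies the
      values of \<open>E\<close> by \<open>\<epsilon> j\<close> and turns the kernel for index 1
      into the kernel for index \<open>j\<close>.\<close>
    have Mj: "M j = \<epsilon> j * M 1" if j: "j \<in> {1..<r}" for j
    proof -
      have exps: "(w ^ j) ^ (s * (r - 1)) = w ^ (s * (r - j))" for s
      proof -
        have "j * (r - 1) = (r - j) + r * (j - 1)"
          using j r1 by (simp add: algebra_simps diff_mult_distrib2)
        then have "(w ^ j) ^ (r - 1) = w ^ (r - j) * (w ^ r) ^ (j - 1)"
          by (simp only: power_mult[symmetric] power_add[symmetric])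
        then have "(w ^ j) ^ (r - 1) = w ^ (r - j)" using w by simp
        then show ?thesis by (metis mult.commute power_mult)
      qed
      have "of_nat (r * N 1) = of_nat m + (\<Sum>s\<in>{1..<r}. E ((w ^ j) ^ s) * (w ^ j) ^ (s * (r - 1)))"
        by (rule inv[OF prim[OF nd[OF j]] r1])
      also have "(\<Sum>s\<in>{1..<r}. E ((w ^ j) ^ s) * (w ^ j) ^ (s * (r - 1))) =
          of_int (\<epsilon> j) * (\<Sum>s\<in>{1..<r}. E (w ^ s) * w ^ (s * (r - j)))"
        unfolding sum_distrib_left exps
        by (intro sum.cong refl) (simp add: power_mult[symmetric] mult[OF nd[OF j] nd])
      finally have "of_int (int r * M 1) = of_int (\<epsilon> j) * (\<Sum>s\<in>{1..<r}. E (w ^ s) * w ^ (s * (r - j)))"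
        unfolding M_def m0 by (simp add: algebra_simps)
      moreover have "of_int (int r * M j) = (\<Sum>s\<in>{1..<r}. E (w ^ s) * w ^ (s * (r - j)))"
        using inv[OF w, of j] j unfolding M_def m0 by (simp add: algebra_simps)
      ultimately have "of_int (int r * M 1) = (of_int (\<epsilon> j * (int r * M j)) :: complex)" by simp
      then have "int r * M 1 = int r * (\<epsilon> j * M j)" by (simp only: of_int_eq_iff) (simp add: mult_ac)
      then have "M 1 = \<epsilon> j * M j" using r1 by simp
      then have "\<epsilon> j * M 1 = (\<epsilon> j * \<epsilon> j) * M j" by simp
      then show ?thesis using \<epsilon>\<epsilon> by simp
    qed
    have aM: "of_real a = of_int (M 1) * g"
    proof -
      have "(\<Sum>t<r. w ^ t) = 0" using sum_root_powers[OF r w, of 1] r1 by simp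
      \<comment> \<open>Subtracting \<open>N 0\<close> times the vanishing sum of all powers of
        \<open>w\<close> replaces \<open>N\<close> by \<open>M\<close> and removes the term at
        0.\<close>
      then have "of_real a = (\<Sum>t<r. of_nat (N t) * w ^ t) - of_nat (N 0) * (\<Sum>t<r. w ^ t)"
        using val by simp
      also have "\<dots> = (\<Sum>t<r. of_int (M t) * w ^ t)"
        unfolding M_def sum_distrib_left sum_subtractf[symmetric] by (simp add: algebra_simps)
      also have "\<dots> = (\<Sum>t\<in>{1..<r}. of_int (\<epsilon> t * M 1) * w ^ t)"
      proof -
        have "M 0 = 0" by (simp add: M_def)
        moreover have "(\<Sum>t\<in>{1..<r}. of_int (M t) * w ^ t) = (\<Sum>t\<in>{1..<r}. of_int (\<epsilon> t * M 1) * w ^ t)"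
          by (intro sum.cong refl) (simp only: Mj)
        ultimately show ?thesis unfolding split by simp
      qed
      finally show ?thesis unfolding g_def by (simp add: sum_distrib_left mult_ac)
    qed
    \<comment> \<open>As \<open>a\<close> is real, it also equals \<open>M 1\<close> times the
      conjugate of \<open>g\<close>; together with \<open>rM1\<close> this eliminates the Gauss
      sum.\<close>
    have "of_real a = of_int (M 1) * cnj g" using arg_cong[OF aM, of cnj] by simp
    then have "of_int (int r * M 1) * of_int (M 1) = (of_real a * of_real a :: complex)"
      unfolding rM1 by (simp add: mult_ac)
    then have "complex_of_real (real r * (of_int (M 1))\<^sup>2) = of_real (a\<^sup>2)"
      by (simp add: power2_eq_square mult_ac)
    then have a2: "a\<^sup>2 = real r * (of_int (M 1))\<^sup>2" by (simp only: of_real_eq_iff)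
    have "real_of_int ((int r * (M 1)\<^sup>2 + 4 * (int m + 1)) * k\<^sup>2) = of_int (int r * (M 1)\<^sup>2 * l\<^sup>2)"
      using disc(1) unfolding a2 by simp
    then have "(int r * (M 1)\<^sup>2 + 4 * (int m + 1)) * k\<^sup>2 = int r * (M 1)\<^sup>2 * l\<^sup>2"
      by (simp only: of_int_eq_iff)
    moreover have "M 1 \<noteq> 0" using a2 a0 by auto
    ultimately show ?thesis
      using odd_prime_discriminant_neq[OF r \<open>r \<noteq> 2\<close>, of "int m" "M 1" l k] m0 disc(2) by simp
  qed
qed

section \<open>Distance regularity from common neighbours\<close>

text \<open>A function that grows by at most one along arcs bounds the length of every walk from
  below; if each positive value has a predecessor with value one less, a walk of that length exists.
  This replaces the infimum over walks by local conditions.\<close>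

lemma gdist_eqI:
  fixes \<delta> :: "'v \<Rightarrow> 'v \<Rightarrow> nat"
  assumes X: "pair_graph X" and uv: "u \<in> pverts X" "v \<in> pverts X"
    and refl: "\<delta> u u = 0"
    and zero: "\<And>v. v \<in> pverts X \<Longrightarrow> \<delta> u v = 0 \<Longrightarrow> u = v"
    and step: "\<And>v w. (v, w) \<in> parcs X \<Longrightarrow> \<delta> u w \<le> Suc (\<delta> u v)"
    and pred: "\<And>v k. v \<in> pverts X \<Longrightarrow> \<delta> u v = Suc k \<Longrightarrow> \<exists>w. (w, v) \<in> parcs X \<and> \<delta> u w = k"
  shows "gdist X u v = ereal (real (\<delta> u v))"
proof -
  interpret pair_graph X by fact
  have cost: "awalk_cost (\<lambda>_. 1) p = real (length p)" for p
    by (induction p) auto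
  have lower: "\<delta> u y \<le> length p + \<delta> u x" if "awalk x p y" for x p y
    using that
  proof (induction p arbitrary: x)
    case Nil
    then show ?case by (simp add: awalk_Nil_iff)
  next
    case (Cons e p)
    then have "e \<in> parcs X" "x = fst e" "awalk (snd e) p y" by (simp_all add: awalk_Cons_iff)
    with step[of "fst e" "snd e"] Cons.IH[of "snd e"] show ?case by simp
  qed
  have upper: "\<exists>p. awalk u p v \<and> length p = k" if "v \<in> pverts X" "\<delta> u v = k" for v k
    using that
  proof (induction k arbitrary: v)
    case 0
    then have "u = v" using zero by simp
    then show ?case using 0 by (intro exI[of _ "[]"]) (simp add: awalk_Nil_iff)
  next
    case (Suc k)
    obtain w where w: "(w, v) \<in> parcs X" "\<delta> u w = k" using pred[OF Suc.prems] by blast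
    then obtain p where p: "awalk u p w" "length p = k"
      using Suc.IH[of w] in_arcsD1 by blast
    have "awalk w [(w, v)] v" using w in_arcsD2 by (simp add: awalk_Cons_iff awalk_Nil_iff)
    then have "awalk u (p @ [(w, v)]) v" using p(1) by (rule awalk_appendI[rotated])
    then show ?case using p(2) by (intro exI[of _ "p @ [(w, v)]"]) simp
  qed
  obtain p where p: "awalk u p v" "length p = \<delta> u v" using upper uv(2) by blast
  have "gdist X u v = (INF p\<in>{p. awalk u p v}. ereal (real (length p)))"
    unfolding gdist_def \<mu>_def cost by simp
  also have "\<dots> = ereal (real (\<delta> u v))"
  proof (rule antisym)
    show "(INF p\<in>{p. awalk u p v}. ereal (real (length p))) \<le> ereal (real (\<delta> u v))"
      using p by (intro INF_lower2[of p]) auto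
    show "ereal (real (\<delta> u v)) \<le> (INF p\<in>{p. awalk u p v}. ereal (real (length p)))"
      using lower refl by (intro INF_greatest) fastforce
  qed
  finally show ?thesis .
qed

lemma connectedI_reachable:
  assumes "pverts X \<noteq> {}"
    and "\<And>u v. u \<in> pverts X \<Longrightarrow> v \<in> pverts X \<Longrightarrow> u \<rightarrow>\<^sup>*\<^bsub>with_proj X\<^esub> v"
  shows "Digraph_Component.connected (with_proj X)"
  unfolding connected_conv using assms
  by (auto simp: reachable_def symcl_def intro: rtrancl_on_mono)

text \<open>Taking the fibres as preimages under a projection \<open>\<pi>\<close> turns lying in
  the same fibre into an equation; \<open>unique_lift\<close> is the perfect matching between two
  fibres.\<close>

locale fibred_graph =
  fixes X :: "'v pair_pre_digraph" and \<pi> :: "'v \<Rightarrow> 'b" and B :: "'b set" and r :: nat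
  assumes pair_graph: "pair_graph X"
    and finite_base: "finite B"
    and proj_mem: "v \<in> pverts X \<Longrightarrow> \<pi> v \<in> B"
    and card_fibre: "b \<in> B \<Longrightarrow> card {v \<in> pverts X. \<pi> v = b} = r"
    and proj_arc: "(u, v) \<in> parcs X \<Longrightarrow> \<pi> u \<noteq> \<pi> v"
    and unique_lift: "u \<in> pverts X \<Longrightarrow> b \<in> B \<Longrightarrow> b \<noteq> \<pi> u \<Longrightarrow> \<exists>!v. (u, v) \<in> parcs X \<and> \<pi> v = b"
    and card_base: "2 \<le> card B"
    and fibre_size: "2 \<le> r"
begin

sublocale pair_graph X by (rule pair_graph)

definition fibres :: "'v set set" where
  "fibres = (\<lambda>b. {v \<in> pverts X. \<pi> v = b}) ` B"

lemma arc_sym: "(u, v) \<in> parcs X \<Longrightarrow> (v, u) \<in> parcs X"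
  by (rule arcs_symmetric)

lemma fibre_nonempty: "b \<in> B \<Longrightarrow> \<exists>v \<in> pverts X. \<pi> v = b"
  using card_fibre[of b] fibre_size by (metis (mono_tags, lifting) Collect_empty_eq card.empty not_numeral_le_zero)

lemma unique_lift_eq: "(u, v) \<in> parcs X \<Longrightarrow> (u, w) \<in> parcs X \<Longrightarrow> \<pi> v = \<pi> w \<Longrightarrow> v = w"
  using unique_lift[of u "\<pi> w"] proj_arc[of u w] proj_mem in_arcsD1 in_arcsD2 by metis

lemma finite_fibre: "finite {v \<in> pverts X. \<pi> v = b}"
  using pair_finite_verts by simp

lemma cover_of_complete: "cover_of_complete (card B) r X fibres"
proof -
  have inj: "inj_on (\<lambda>b. {v \<in> pverts X. \<pi> v = b}) B"
    using fibre_nonempty by (intro inj_onI) blast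
  have "pverts X = (\<Union>b\<in>B. {v \<in> pverts X. \<pi> v = b})" using proj_mem by auto
  then have "card (pverts X) = (\<Sum>b\<in>B. card {v \<in> pverts X. \<pi> v = b})"
    using card_UN_disjoint[OF finite_base, of "\<lambda>b. {v \<in> pverts X. \<pi> v = b}"] finite_fibre by auto
  then have c1: "card (pverts X) = r * card B" using card_fibre by simp
  have c2: "partition_on (pverts X) fibres"
  proof (rule partition_onI)
    show "\<Union> fibres = pverts X" unfolding fibres_def using proj_mem by auto
    show "disjnt p q" if "p \<in> fibres" "q \<in> fibres" "p \<noteq> q" for p q
      using that unfolding fibres_def disjnt_def by auto
    show "{} \<notin> fibres" using fibre_nonempty unfolding fibres_def by blast
  qed
  have c3: "card fibres = card B" unfolding fibres_def using inj by (rule card_image)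
  have c4: "\<forall>A\<in>fibres. card A = r" unfolding fibres_def using card_fibre by auto
  have c5: "\<forall>A\<in>fibres. \<forall>u\<in>A. \<forall>v\<in>A. (u, v) \<notin> parcs X"
    unfolding fibres_def using proj_arc by fastforce
  have c6: "\<exists>!v. v \<in> C \<and> (u, v) \<in> parcs X" if "A \<in> fibres" "C \<in> fibres" "A \<noteq> C" "u \<in> A" for A C u
  proof -
    note AC = that(1,2)
    obtain a c where ac: "a \<in> B" "c \<in> B" "A = {v \<in> pverts X. \<pi> v = a}" "C = {v \<in> pverts X. \<pi> v = c}"
      using AC unfolding fibres_def by blast
    then have "u \<in> pverts X" "c \<noteq> \<pi> u" using that(3,4) by auto
    then have "\<exists>!v. (u, v) \<in> parcs X \<and> \<pi> v = c" using unique_lift ac(2) by blast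
    moreover have "v \<in> C \<and> (u, v) \<in> parcs X \<longleftrightarrow> (u, v) \<in> parcs X \<and> \<pi> v = c" for v
      using ac in_arcsD2 by auto
    ultimately show ?thesis by simp
  qed
  show ?thesis
    unfolding cover_of_complete_def
    by (intro conjI pair_graph c1 c2 c3 c4 c5 ballI impI c6)
qed

lemma card_neighbours:
  assumes "v \<in> pverts X"
  shows "card {w \<in> pverts X. (v, w) \<in> parcs X} = card B - 1"
proof -
  have "bij_betw \<pi> {w \<in> pverts X. (v, w) \<in> parcs X} (B - {\<pi> v})"
    unfolding bij_betw_def
  proof (intro conjI subset_antisym subsetI)
    show "inj_on \<pi> {w \<in> pverts X. (v, w) \<in> parcs X}"
      by (auto intro!: inj_onI unique_lift_eq)
    fix b assume "b \<in> B - {\<pi> v}"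
    then obtain w where "(v, w) \<in> parcs X" "\<pi> w = b" using unique_lift[OF assms] by blast
    then show "b \<in> \<pi> ` {w \<in> pverts X. (v, w) \<in> parcs X}" using in_arcsD2 by blast
  qed (use proj_mem proj_arc in fastforce)
  then have "card {w \<in> pverts X. (v, w) \<in> parcs X} = card (B - {\<pi> v})" by (rule bij_betw_same_card)
  then show ?thesis using proj_mem[OF assms] finite_base by simp
qed

end

text \<open>Two counts of common neighbours, both for pairs in different fibres, determine all
  intersection numbers: vertices of the same fibre have no common neighbour because lifts are
  unique.\<close>

locale drackn_graph = fibred_graph +
  fixes c k :: nat
  assumes c_pos: "1 \<le> c"
    and common_nonadjacent: "u \<in> pverts X \<Longrightarrow> v \<in> pverts X \<Longrightarrow> \<pi> u \<noteq> \<pi> v \<Longrightarrow> (u, v) \<notin> parcs X \<Longrightarrow>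
      card {w \<in> pverts X. (u, w) \<in> parcs X \<and> (w, v) \<in> parcs X} = c"
    and common_adjacent: "(u, v) \<in> parcs X \<Longrightarrow>
      card {w \<in> pverts X. (u, w) \<in> parcs X \<and> (w, v) \<in> parcs X} = k"
begin

definition \<delta> :: "'a \<Rightarrow> 'a \<Rightarrow> nat" where
  "\<delta> u v = (if u = v then 0 else if (u, v) \<in> parcs X then 1 else if \<pi> u = \<pi> v then 3 else 2)"

lemma gdist: "gdist X u v = ereal (real (\<delta> u v))" if u: "u \<in> pverts X" and v: "v \<in> pverts X"
proof (rule gdist_eqI[OF pair_graph u v])
  fix v w assume vw: "(v, w) \<in> parcs X"
  show "\<delta> u w \<le> Suc (\<delta> u v)"
  \<comment> \<open>Only a jump from 1 to 3 could violate the bound. Then \<open>u\<close> and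
    \<open>w\<close> would be neighbours of \<open>v\<close> in one fibre, hence equal.\<close>
  proof (cases "(u, v) \<in> parcs X \<and> \<pi> u = \<pi> w")
    case True
    then have "u = w" using unique_lift_eq[of v u w] vw arc_sym by blast
    then show ?thesis by (simp add: \<delta>_def)
  next
    case False
    then show ?thesis using vw by (auto simp: \<delta>_def)
  qed
next
  fix v k assume v: "v \<in> pverts X" and k: "\<delta> u v = Suc k"
  consider "k = 0" "(u, v) \<in> parcs X" | "k = 1" "(u, v) \<notin> parcs X" "\<pi> u \<noteq> \<pi> v"
    | "k = 2" "(u, v) \<notin> parcs X" "\<pi> u = \<pi> v" "u \<noteq> v"
    using k by (auto simp: \<delta>_def split: if_splits)
  then show "\<exists>w. (w, v) \<in> parcs X \<and> \<delta> u w = k"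
  proof cases
    case 1
    then show ?thesis by (auto simp: \<delta>_def)
  next
    case 2
    have "{w \<in> pverts X. (u, w) \<in> parcs X \<and> (w, v) \<in> parcs X} \<noteq> {}"
      using common_nonadjacent[OF u v 2(3,2)] c_pos by (metis card.empty not_one_le_zero)
    then obtain w where "(u, w) \<in> parcs X" "(w, v) \<in> parcs X" by blast
    moreover have "u \<noteq> w" using calculation proj_arc by blast
    ultimately show ?thesis using 2 by (auto simp: \<delta>_def)
  next
    case 3
    \<comment> \<open>Any neighbour \<open>w\<close> of \<open>v\<close> serves: if it were adjacent
      to \<open>u\<close>, it would have two neighbours in the common fibre of \<open>u\<close> and
      \<open>v\<close>.\<close>
    have "\<not> B \<subseteq> {\<pi> v}" using card_base card_mono[of "{\<pi> v}" B] by auto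
    then obtain b where "b \<in> B" "b \<noteq> \<pi> v" by blast
    then obtain w where w: "(v, w) \<in> parcs X" "\<pi> w = b" using unique_lift[OF v] by blast
    have "(u, w) \<notin> parcs X" using unique_lift_eq[of w u v] w 3 arc_sym by blast
    moreover have "\<pi> u \<noteq> \<pi> w" using w 3 \<open>b \<noteq> \<pi> v\<close> by simp
    ultimately show ?thesis using w 3 arc_sym by (intro exI[of _ w]) (auto simp: \<delta>_def)
  qed
qed (auto simp: \<delta>_def split: if_splits)

lemma not_arc_self: "(v, v) \<notin> parcs X" using proj_arc by blast

lemma graph_diameter: "graph_diameter X = 3"
proof (rule antisym)
  show "graph_diameter X \<le> 3"
    unfolding graph_diameter_def by (intro SUP_least) (auto simp: gdist \<delta>_def)
  obtain b where b: "b \<in> B" using card_base by fastforce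
  then have "card {v \<in> pverts X. \<pi> v = b} \<ge> 2" using card_fibre fibre_size by simp
  then have large: "\<not> {v \<in> pverts X. \<pi> v = b} \<subseteq> {u}" for u
    using card_mono[of "{u}" "{v \<in> pverts X. \<pi> v = b}"] by auto
  obtain u where u: "u \<in> pverts X" "\<pi> u = b" using fibre_nonempty[OF b] by blast
  obtain v where v: "v \<in> pverts X" "\<pi> v = b" "u \<noteq> v" using large[of u] by blast
  note uv = u v
  have "(u, v) \<notin> parcs X" using proj_arc[of u v] uv by auto
  then have "3 = gdist X u v" using uv by (simp add: gdist \<delta>_def)
  also have "gdist X u v \<le> (SUP v\<in>pverts X. gdist X u v)" by (rule SUP_upper[OF v(1)])
  also have "\<dots> \<le> graph_diameter X" unfolding graph_diameter_def by (rule SUP_upper[OF u(1)])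
  finally show "3 \<le> graph_diameter X" .
qed

lemma antipodal_rel: "antipodal_rel X = {(u, v) \<in> pverts X \<times> pverts X. \<pi> u = \<pi> v}"
  unfolding antipodal_rel_def graph_diameter
  by (auto simp: gdist \<delta>_def dest: proj_arc split: if_splits)

lemma antipodal: "antipodal X"
  unfolding antipodal_def antipodal_rel
  by (intro equivI refl_onI symI transI) auto

lemma antipodal_classes: "antipodal_classes X = fibres"
proof -
  have "antipodal_rel X `` {v} = {w \<in> pverts X. \<pi> w = \<pi> v}" if "v \<in> pverts X" for v
    using that unfolding antipodal_rel by auto
  then have "antipodal_classes X = (\<lambda>v. {w \<in> pverts X. \<pi> w = \<pi> v}) ` pverts X"
    unfolding antipodal_classes_def quotient_def by auto
  also have "\<dots> = (\<lambda>b. {w \<in> pverts X. \<pi> w = b}) ` \<pi> ` pverts X" by (simp add: image_image)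
  also have "\<pi> ` pverts X = B" using fibre_nonempty proj_mem by blast
  finally show ?thesis unfolding fibres_def .
qed

lemma card_common:
  assumes "u \<in> pverts X" "v \<in> pverts X"
  shows "\<delta> u v = 2 \<Longrightarrow> card {w \<in> pverts X. (u, w) \<in> parcs X \<and> (w, v) \<in> parcs X} = c"
    and "\<delta> u v = 1 \<Longrightarrow> card {w \<in> pverts X. (u, w) \<in> parcs X \<and> (w, v) \<in> parcs X} = k"
  using common_nonadjacent[OF assms] common_adjacent[of u v]
  by (auto simp: \<delta>_def split: if_splits)

lemma distance_regular: "distance_regular X"
proof -
  \<comment> \<open>The intersection array is (n - 1, n - 2 - k, 1; 1, c, n - 1) with n =
    \<open>card B\<close>.\<close>
  define b' where "b' i = (if i = 0 then card B - 1 else if i = 1 then card B - 2 - k else if i = 2 then 1 else 0)"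
    for i :: nat
  define c' where "c' i = (if i = 0 then 0 else if i = 1 then 1 else if i = 2 then c else card B - 1)" for i :: nat
  let ?N = "\<lambda>v. {w \<in> pverts X. (v, w) \<in> parcs X}"
  have "card {w \<in> pverts X. (v, w) \<in> parcs X \<and> gdist X u w = ereal (real i + 1)} = b' i \<and>
        card {w \<in> pverts X. (v, w) \<in> parcs X \<and> gdist X u w = ereal (real i - 1)} = c' i"
    if u: "u \<in> pverts X" and v: "v \<in> pverts X" and i: "gdist X u v = ereal (real i)" for i u v
  proof -
    have i: "\<delta> u v = i" using i u v by (simp add: gdist)
    have up: "{w \<in> pverts X. (v, w) \<in> parcs X \<and> gdist X u w = ereal (real i + 1)} =
        {w \<in> pverts X. (v, w) \<in> parcs X \<and> \<delta> u w = Suc i}"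
      using u by (auto simp: gdist)
    have down: "{w \<in> pverts X. (v, w) \<in> parcs X \<and> gdist X u w = ereal (real i - 1)} =
        {w \<in> pverts X. (v, w) \<in> parcs X \<and> Suc (\<delta> u w) = i}"
      using u by (auto simp: gdist)
    consider "i = 0" "u = v" | "i = 1" "(u, v) \<in> parcs X" | "i = 2" "(u, v) \<notin> parcs X" "\<pi> u \<noteq> \<pi> v"
      | "i = 3" "(u, v) \<notin> parcs X" "\<pi> u = \<pi> v" "u \<noteq> v"
      using i by (auto simp: \<delta>_def split: if_splits)
    then show ?thesis
    proof cases
      case 1
      have "{w \<in> pverts X. (v, w) \<in> parcs X \<and> \<delta> u w = Suc i} = ?N v"
        using 1 not_arc_self by (auto simp: \<delta>_def)
      moreover have "{w \<in> pverts X. (v, w) \<in> parcs X \<and> Suc (\<delta> u w) = i} = {}" using 1 by auto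
      ultimately show ?thesis unfolding up down using card_neighbours[OF v] 1 by (simp add: b'_def c'_def)
    next
      case 2
      let ?C = "{w \<in> pverts X. (u, w) \<in> parcs X \<and> (w, v) \<in> parcs X}"
      \<comment> \<open>The only neighbour of \<open>v\<close> in the fibre of \<open>u\<close> is
        \<open>u\<close>, so a neighbour of \<open>v\<close> that is neither \<open>u\<close> nor
        adjacent to \<open>u\<close> is at distance 2 from \<open>u\<close>.\<close>
      have "\<pi> u \<noteq> \<pi> w" if "(v, w) \<in> parcs X" "w \<noteq> u" for w
        using that 2 unique_lift_eq[of v u w] arc_sym by blast
      then have "{w \<in> pverts X. (v, w) \<in> parcs X \<and> \<delta> u w = Suc i} = ?N v - insert u ?C"
        using 2 arc_sym by (auto simp: \<delta>_def split: if_splits)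
      moreover have "insert u ?C \<subseteq> ?N v" using 2 u arc_sym by auto
      moreover have "card (insert u ?C) = Suc k"
        using common_adjacent[OF 2(2)] not_arc_self pair_finite_verts by simp
      ultimately have "card {w \<in> pverts X. (v, w) \<in> parcs X \<and> \<delta> u w = Suc i} = card B - 1 - Suc k"
        using card_neighbours[OF v] pair_finite_verts by (simp add: card_Diff_subset)
      moreover have "{w \<in> pverts X. (v, w) \<in> parcs X \<and> Suc (\<delta> u w) = i} = {u}"
        using 2 u arc_sym by (auto simp: \<delta>_def split: if_splits)
      ultimately show ?thesis unfolding up down using 2 by (simp add: b'_def c'_def)
    next
      case 3
      \<comment> \<open>The unique neighbour of \<open>v\<close> in the fibre of \<open>u\<close> is
        the only one at distance 3 from \<open>u\<close>.\<close>
      obtain w0 where w0: "(v, w0) \<in> parcs X" "\<pi> w0 = \<pi> u"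
        using unique_lift[OF v proj_mem[OF u]] 3 by auto
      have "w0 \<noteq> u" using w0 3 arc_sym by blast
      moreover have "(u, w0) \<notin> parcs X" using w0 proj_arc[of u w0] by auto
      ultimately have dist0: "\<delta> u w0 = 3" using w0 by (simp add: \<delta>_def)
      have uniq: "w = w0" if "(v, w) \<in> parcs X" "\<delta> u w = 3" for w
      proof -
        have "\<pi> w = \<pi> u" using that(2) by (simp add: \<delta>_def split: if_splits)
        then show ?thesis using unique_lift_eq[OF that(1) w0(1)] w0(2) by simp
      qed
      have single: "{w \<in> pverts X. (v, w) \<in> parcs X \<and> \<delta> u w = Suc i} = {w0}"
      proof (intro subset_antisym subsetI)
        fix w assume "w \<in> {w \<in> pverts X. (v, w) \<in> parcs X \<and> \<delta> u w = Suc i}"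
        then show "w \<in> {w0}" using uniq[of w] 3(1) by simp
      qed (use dist0 3(1) w0(1) in_arcsD2[OF w0(1)] in simp)
      have "Suc (\<delta> u w) = i \<longleftrightarrow> (u, w) \<in> parcs X" for w
        using 3(1) not_arc_self by (simp add: \<delta>_def)
      then have "{w \<in> pverts X. (v, w) \<in> parcs X \<and> Suc (\<delta> u w) = i} =
          {w \<in> pverts X. (u, w) \<in> parcs X \<and> (w, v) \<in> parcs X}"
        using arc_sym by auto
      then show ?thesis
        unfolding up down single using common_nonadjacent[OF u v 3(3,2)] 3(1) by (simp add: b'_def c'_def)
    next
      case 4
      \<comment> \<open>By uniqueness of lifts \<open>u\<close> and \<open>v\<close> share no
        neighbour, so all neighbours of \<open>v\<close> are at distance 2 from
        \<open>u\<close>.\<close>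
      have "(u, w) \<notin> parcs X" "\<pi> u \<noteq> \<pi> w" "u \<noteq> w" if "(v, w) \<in> parcs X" for w
        using that 4 unique_lift_eq[of w u v] arc_sym[of v w] arc_sym[of u w] proj_arc[of v w] by auto
      then have "{w \<in> pverts X. (v, w) \<in> parcs X \<and> Suc (\<delta> u w) = i} = ?N v"
        "{w \<in> pverts X. (v, w) \<in> parcs X \<and> \<delta> u w = Suc i} = {}"
        using 4 by (auto simp: \<delta>_def)
      then show ?thesis unfolding up down using card_neighbours[OF v] 4 by (simp add: b'_def c'_def)
    qed
  qed
  moreover have "Digraph_Component.connected (with_proj X)"
  proof (rule connectedI_reachable)
    show "pverts X \<noteq> {}" using card_base fibre_nonempty by fastforce
    show "u \<rightarrow>\<^sup>*\<^bsub>with_proj X\<^esub> v" if "u \<in> pverts X" "v \<in> pverts X" for u v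
    proof (rule ccontr)
      assume "\<not> u \<rightarrow>\<^sup>*\<^bsub>with_proj X\<^esub> v"
      then have "gdist X u v = \<infinity>" unfolding gdist_def by (rule shortest_path_inf)
      then show False using that by (simp add: gdist)
    qed
  qed
  ultimately show ?thesis unfolding distance_regular_def using pair_graph by blast
qed

theorem drackn: "drackn (card B) r c X fibres"
proof -
  have "card {w \<in> pverts X. (u, w) \<in> parcs X \<and> (w, v) \<in> parcs X} = c"
    if "u \<in> pverts X" "v \<in> pverts X" "gdist X u v = 2" for u v
  proof -
    have "ereal (real (\<delta> u v)) = ereal 2" using that gdist by simp
    then have "\<delta> u v = 2" by (simp only: ereal.inject)
    then show ?thesis using card_common(1) that by blast
  qed
  then show ?thesis
    unfolding drackn_def
    by (intro conjI card_base fibre_size c_pos cover_of_complete distance_regular graph_diameter antipodal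
      antipodal_classes ballI impI)
qed

end

section \<open>Rotations\<close>

definition rot :: "nat \<Rightarrow> nat \<Rightarrow> nat \<Rightarrow> nat" where
  "rot r k i = (if i \<in> {1..r} then (i - 1 + k) mod r + 1 else i)"

lemma rot_mem: "i \<in> {1..r} \<Longrightarrow> rot r k i \<in> {1..r}"
  by (auto simp: rot_def Suc_le_eq)

text \<open>The points 1, ..., r form a complete residue system, so equalities of points become
  congruences, from which the offset by one disappears.\<close>

lemma rot_eq_iff:
  assumes "i \<in> {1..r}" "j \<in> {1..r}"
  shows "rot r k i = j \<longleftrightarrow> [i + k = j] (mod r)"
proof -
  have "rot r k i = j \<longleftrightarrow> (i - 1 + k) mod r = (j - 1) mod r"
    using assms by (auto simp: rot_def)
  also have "\<dots> \<longleftrightarrow> [(i - 1 + k) + 1 = (j - 1) + 1] (mod r)"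
    unfolding cong_add_rcancel_nat by (simp add: cong_def)
  also have "(i - 1 + k) + 1 = i + k" using assms by auto
  also have "(j - 1) + 1 = j" using assms by auto
  finally show ?thesis .
qed

lemma rot_cong: "i \<in> {1..r} \<Longrightarrow> [rot r k i = i + k] (mod r)"
  using rot_eq_iff[of i r "rot r k i" k] rot_mem[of i r k] by (simp add: cong_sym_eq)

lemma rot_add: "rot r a \<circ> rot r b = rot r (a + b)"
proof
  fix i
  show "(rot r a \<circ> rot r b) i = rot r (a + b) i"
  proof (cases "i \<in> {1..r}")
    case True
    have m: "rot r b i \<in> {1..r}" "rot r (a + b) i \<in> {1..r}" by (rule rot_mem[OF True])+
    have "[rot r b i + a = i + b + a] (mod r)" using rot_cong[OF True] by (simp add: cong_add_rcancel_nat)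
    also have "[i + b + a = rot r (a + b) i] (mod r)" using rot_cong[OF True, of "a + b"] by (simp add: cong_sym_eq add_ac)
    finally show ?thesis using m by (simp add: rot_eq_iff)
  next
    case False
    then show ?thesis by (auto simp: rot_def)
  qed
qed

lemma rot_eq_id_iff:
  assumes "0 < r"
  shows "rot r k = id \<longleftrightarrow> r dvd k"
proof
  assume "rot r k = id"
  then have "[1 + k = 1] (mod r)" using rot_eq_iff[of 1 r 1 k] assms by simp
  then have "[1 + k = 1 + 0] (mod r)" by simp
  then have "[k = 0] (mod r)" by (simp only: cong_add_lcancel_nat)
  then show "r dvd k" by (simp add: cong_0_iff)
next
  assume k: "r dvd k"
  show "rot r k = id"
  proof
    fix i
    show "rot r k i = id i"
    proof (cases "i \<in> {1..r}")
      case True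
      have "[i + k = i + 0] (mod r)" unfolding cong_add_lcancel_nat using k by (simp add: cong_0_iff)
      then show ?thesis using rot_eq_iff[OF True True, of k] by simp
    qed (auto simp: rot_def)
  qed
qed

lemma rot_fixed_point: "0 < r \<Longrightarrow> i \<in> {1..r} \<Longrightarrow> rot r k i = i \<Longrightarrow> rot r k = id"
  using rot_eq_iff[of i r i k] cong_add_lcancel_nat[of i k 0 r]
  by (simp add: rot_eq_id_iff cong_0_iff)

lemma rot_inverse: "0 < r \<Longrightarrow> r dvd a + b \<Longrightarrow> rot r a \<circ> rot r b = id"
  by (simp add: rot_add rot_eq_id_iff)

lemma rot_permutes: "0 < r \<Longrightarrow> rot r k permutes {1..r}"
proof (rule bij_imp_permutes)
  assume r: "0 < r"
  \<comment> \<open>The number \<open>k * (r - 1)\<close> represents -k modulo r without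
    subtraction.\<close>
  have "rot r k \<circ> rot r (k * (r - 1)) = id" "rot r (k * (r - 1)) \<circ> rot r k = id"
  proof -
    have eq: "k + k * (r - 1) = k * r" using r by (cases r) auto
    have d: "r dvd k + k * (r - 1)" unfolding eq by simp
    then show "rot r k \<circ> rot r (k * (r - 1)) = id" by (rule rot_inverse[OF r])
    have "r dvd k * (r - 1) + k" using d by (simp only: add.commute)
    then show "rot r (k * (r - 1)) \<circ> rot r k = id" by (rule rot_inverse[OF r])
  qed
  then show "bij_betw (rot r k) {1..r} {1..r}"
    by (intro bij_betw_byWitness[of _ "rot r (k * (r - 1))"] ballI image_subsetI rot_mem)
      (simp_all add: fun_eq_iff)
qed (auto simp: rot_def)

lemma rot_carrier: "0 < r \<Longrightarrow> rot r k \<in> carrier (sym_group r)"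
  unfolding sym_group_carrier by (rule rot_permutes)

lemma rot_inv:
  assumes "0 < r" "r dvd a + b"
  shows "inv\<^bsub>sym_group r\<^esub> (rot r a) = rot r b"
proof (rule group.inv_equality[OF sym_group_is_group])
  show "rot r b \<otimes>\<^bsub>sym_group r\<^esub> rot r a = \<one>\<^bsub>sym_group r\<^esub>"
    using rot_inverse[of r b a] assms by (simp add: sym_group_mult sym_group_one add.commute)
qed (use assms in \<open>auto simp: rot_carrier\<close>)

lemma generate_rot:
  assumes r: "0 < r" and S: "S \<subseteq> range (rot r)" "rot r 1 \<in> S"
  shows "generate (sym_group r) S = range (rot r)"
proof
  interpret group "sym_group r" by (rule sym_group_is_group)
  have "subgroup (range (rot r)) (sym_group r)"
  proof (rule subgroupI)
    fix a assume "a \<in> range (rot r)"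
    then obtain k where a: "a = rot r k" by blast
    have "k + k * (r - 1) = k * r" using r by (cases r) auto
    then have "inv\<^bsub>sym_group r\<^esub> a = rot r (k * (r - 1))" unfolding a using r by (intro rot_inv) auto
    then show "inv\<^bsub>sym_group r\<^esub> a \<in> range (rot r)" by simp
  qed (use r in \<open>auto simp: rot_carrier sym_group_mult rot_add\<close>)
  then show "generate (sym_group r) S \<subseteq> range (rot r)" using S(1) by (rule generate_subgroup_incl[rotated])
  have "rot r k \<in> generate (sym_group r) S" for k
  proof (induction k)
    case 0
    have "rot r 0 = \<one>\<^bsub>sym_group r\<^esub>" using r by (simp add: rot_eq_id_iff sym_group_one)
    then show ?case by (simp add: generate.one)
  next
    case (Suc k)
    have "rot r 1 \<otimes>\<^bsub>sym_group r\<^esub> rot r k \<in> generate (sym_group r) S"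
      using generate.incl[OF S(2)] Suc by (rule generate.eng)
    then show ?case by (simp add: sym_group_mult rot_add)
  qed
  then show "range (rot r) \<subseteq> generate (sym_group r) S" by blast
qed

lemma subgroup_generated_rot:
  assumes "0 < r" "S \<subseteq> range (rot r)" "rot r 1 \<in> S"
  shows "subgroup_generated (sym_group r) S = (sym_group r)\<lparr>carrier := range (rot r)\<rparr>"
proof -
  have "carrier (sym_group r) \<inter> S = S" using assms by (auto simp: rot_carrier)
  then show ?thesis unfolding subgroup_generated_def using generate_rot[OF assms] by simp
qed

text \<open>The shift by \<open>r - i + j\<close> carries \<open>i\<close> to \<open>j\<close>, and
  a rotation with a fixed point is the identity.\<close>

lemma acts_regularly_rot:
  assumes r: "0 < r"
  shows "acts_regularly ((sym_group r)\<lparr>carrier := range (rot r)\<rparr>) {1..r}"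
  unfolding acts_regularly_def
proof (intro ballI conjI)
  fix i assume i: "i \<in> {1..r}"
  have "\<exists>k. rot r k i = j" if j: "j \<in> {1..r}" for j
  proof -
    have "[i + (r - i + j) = j] (mod r)" using i by (simp add: cong_def)
    then show ?thesis using rot_eq_iff[OF i j] by blast
  qed
  then show "Group_Action.orbit ((sym_group r)\<lparr>carrier := range (rot r)\<rparr>) (\<lambda>g. g) i = {1..r}"
    unfolding Group_Action.orbit_def using rot_mem[OF i] by fastforce
  have "rot r 0 = id" using r by (simp add: rot_eq_id_iff)
  then have "id \<in> range (rot r)" by (metis rangeI)
  then show "stabilizer ((sym_group r)\<lparr>carrier := range (rot r)\<rparr>) (\<lambda>g. g) i =
      {\<one>\<^bsub>(sym_group r)\<lparr>carrier := range (rot r)\<rparr>\<^esub>}"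
    unfolding stabilizer_def using rot_fixed_point[OF r i] by (auto simp: sym_group_one)
qed

section \<open>Covers with cyclic voltages\<close>

text \<open>The spanning tree for the normalization: with row 0 of the exponents divisible by r, the
  arc function is trivial on the star at 0.\<close>

definition star_graph :: "nat \<Rightarrow> nat pair_pre_digraph" where
  "star_graph n = \<lparr>pverts = {..<n}, parcs = {(u, v). u < n \<and> v < n \<and> u \<noteq> v \<and> (u = 0 \<or> v = 0)}\<rparr>"

lemma finite_arc_set: "finite {(u, v). u < (n :: nat) \<and> v < n \<and> P u v}"
  by (rule finite_subset[of _ "{..<n} \<times> {..<n}"]) auto

lemma pair_graph_star: "pair_graph (star_graph n)"
  by unfold_locales (auto simp: star_graph_def symmetric_def finite_arc_set intro!: symI)

lemma pair_graph_complete: "pair_graph (complete_graph n)"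
  by unfold_locales (auto simp: complete_graph_def symmetric_def finite_arc_set intro!: symI)

text \<open>Every arc of the star has 0 as an end, so three consecutive arcs meet 0 at least twice;
  the vertices of a cycle without its starting point are distinct, which rules this out.\<close>

lemma star_no_cycle:
  assumes "pre_digraph.cycle (with_proj (star_graph n)) p"
  shows "length p < 3"
proof (rule ccontr)
  interpret pair_graph "star_graph n" by (rule pair_graph_star)
  assume "\<not> length p < 3"
  moreover obtain u where u: "awalk u p u" "distinct (tl (pawalk_verts u p))"
    using assms unfolding cycle_def by auto
  ultimately obtain e1 e2 e3 q where p: "p = e1 # e2 # e3 # q"
    by (auto simp: not_less numeral_3_eq_3 Suc_le_length_iff)
  obtain a b c d where e: "e1 = (u, a)" "e2 = (a, b)" "e3 = (b, d)"
    using u(1) unfolding p by (cases e1; cases e2; cases e3) (auto simp: awalk_Cons_iff)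
  have "(u, a) \<in> parcs (star_graph n)" "(a, b) \<in> parcs (star_graph n)" "(b, d) \<in> parcs (star_graph n)"
    and q: "awalk d q u"
    using u(1) unfolding p e by (simp_all add: awalk_Cons_iff)
  then have arcs: "u = 0 \<or> a = 0" "a = 0 \<or> b = 0" "b = 0 \<or> d = 0"
    by (auto simp: star_graph_def)
  have "distinct (a # b # pawalk_verts d q)" using u(2) unfolding p e by simp
  moreover have "d \<in> set (pawalk_verts d q)" by (cases q) (use q in \<open>auto simp: awalk_Cons_iff\<close>)
  moreover have "u \<in> set (pawalk_verts d q)" 
  proof -
    have "pawalk_verts d q \<noteq> []" by (cases q) auto
    then show ?thesis using last_in_set awlast_of_awalk[OF q, unfolded NOMATCH_def] by metis
  qed
  ultimately show False using arcs by auto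
qed

lemma undirected_tree_star:
  assumes "0 < n"
  shows "undirected_tree (star_graph n)"
proof -
  interpret pair_graph "star_graph n" by (rule pair_graph_star)
  have to0: "u \<rightarrow>\<^sup>*\<^bsub>with_proj (star_graph n)\<^esub> 0" "0 \<rightarrow>\<^sup>*\<^bsub>with_proj (star_graph n)\<^esub> u" if "u < n" for u
  proof -
    have "u \<in> pverts (star_graph n)" "0 \<in> pverts (star_graph n)"
      "u \<noteq> 0 \<Longrightarrow> (u, 0) \<in> parcs (star_graph n)" "u \<noteq> 0 \<Longrightarrow> (0, u) \<in> parcs (star_graph n)"
      using that assms by (simp_all add: star_graph_def)
    then show "u \<rightarrow>\<^sup>*\<^bsub>with_proj (star_graph n)\<^esub> 0" "0 \<rightarrow>\<^sup>*\<^bsub>with_proj (star_graph n)\<^esub> u"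
      by (cases "u = 0"; auto intro: reachable_adjI reachable_refl)+
  qed
  have "Digraph_Component.connected (with_proj (star_graph n))"
  proof (rule connectedI_reachable)
    show "pverts (star_graph n) \<noteq> {}" using assms by (auto simp: star_graph_def)
    show "u \<rightarrow>\<^sup>*\<^bsub>with_proj (star_graph n)\<^esub> v"
      if "u \<in> pverts (star_graph n)" "v \<in> pverts (star_graph n)" for u v
      using that reachable_trans[OF to0(1)[of u] to0(2)[of v]] by (auto simp: star_graph_def)
  qed
  then show ?thesis unfolding undirected_tree_def using pair_graph_star star_no_cycle by force
qed

lemma spanning_star: "spanning (with_proj (star_graph n)) (with_proj (complete_graph n))"
proof -
  interpret S: pair_graph "star_graph n" by (rule pair_graph_star)
  interpret K: pair_graph "complete_graph n" by (rule pair_graph_complete)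
  show ?thesis
    unfolding spanning_def subgraph_def compatible_def
    using S.wf_digraph K.wf_digraph by (auto simp: star_graph_def complete_graph_def)
qed

text \<open>The exponents matter only modulo r; as natural numbers they express negation by
  divisibility of a sum. In \<open>count\<close>, \<open>t\<close> measures by how much the shift
  along u, w, v differs from the direct shift \<open>e u v\<close>.\<close>

locale exponent_matrix =
  fixes n r c k :: nat and e :: "nat \<Rightarrow> nat \<Rightarrow> nat"
  assumes n: "2 \<le> n" and r: "2 \<le> r" and c: "1 \<le> c"
    and skew: "u < n \<Longrightarrow> v < n \<Longrightarrow> u \<noteq> v \<Longrightarrow> r dvd e u v + e v u"
    and base: "0 < v \<Longrightarrow> v < n \<Longrightarrow> r dvd e 0 v"
    and count: "u < n \<Longrightarrow> v < n \<Longrightarrow> u \<noteq> v \<Longrightarrow> t < r \<Longrightarrow>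
      card {w. w < n \<and> w \<noteq> u \<and> w \<noteq> v \<and> [e u w + e w v = e u v + t] (mod r)} = (if t = 0 then k else c)"
begin

abbreviation arcf :: "nat \<Rightarrow> nat \<Rightarrow> nat \<Rightarrow> nat" where
  "arcf u v \<equiv> rot r (e u v)"

abbreviation X where "X \<equiv> arc_cover n r arcf"

lemma r0: "0 < r" using r by simp

lemma arcs_iff: "((u, i), (v, j)) \<in> parcs X \<longleftrightarrow>
    u < n \<and> v < n \<and> u \<noteq> v \<and> i \<in> {1..r} \<and> j \<in> {1..r} \<and> [i + e u v = j] (mod r)"
  unfolding arc_cover_def complete_graph_def using rot_eq_iff by auto

lemma verts: "pverts X = {..<n} \<times> {1..r}" by (simp add: arc_cover_def)

lemma arcs_sym: "((u, i), (v, j)) \<in> parcs X \<Longrightarrow> ((v, j), (u, i)) \<in> parcs X"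
proof -
  assume a: "((u, i), (v, j)) \<in> parcs X"
  then have uv: "u < n" "v < n" "u \<noteq> v" and ij: "[i + e u v = j] (mod r)" by (auto simp: arcs_iff)
  have "[j + e v u = i + e u v + e v u] (mod r)" using ij by (simp add: cong_add_rcancel_nat cong_sym_eq)
  also have "[i + e u v + e v u = i + 0] (mod r)"
    unfolding add.assoc cong_add_lcancel_nat using skew[OF uv] by (simp add: cong_0_iff)
  finally show ?thesis using a by (simp add: arcs_iff)
qed

lemma pair_graph_X: "pair_graph X"
proof -
  have sub: "parcs X \<subseteq> pverts X \<times> pverts X" by (auto simp: arcs_iff verts)
  have fin: "finite (pverts X)" by (simp add: verts)
  show ?thesis
  proof unfold_locales
    show "finite (parcs X)" using sub fin by (meson finite_SigmaI finite_subset)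
    show "symmetric (with_proj X)"
      unfolding symmetric_def by (intro symI) (auto intro: arcs_sym)
  qed (use sub fin arcs_iff in auto)
qed

text \<open>A common neighbour is determined by its base point \<open>w\<close>, and one exists over
  \<open>w\<close> exactly if the two shifts through \<open>w\<close> add up to j - i. If j - i is
  written as \<open>e u v + t\<close>, adjacency of the two vertices means t = 0.\<close>

lemma common_neighbours:
  assumes "u < n" "v < n" "u \<noteq> v" "i \<in> {1..r}" "j \<in> {1..r}"
  shows "card {w \<in> pverts X. ((u, i), w) \<in> parcs X \<and> (w, (v, j)) \<in> parcs X} =
    (if ((u, i), (v, j)) \<in> parcs X then k else c)"
proof -
  \<comment> \<open>The multiple by \<open>r - 1\<close> stands for the negative.\<close>
  define t where "t = (j + (r - 1) * (i + e u v)) mod r"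
  have t: "t < r" unfolding t_def using r0 by simp
  have "[i + e u v + t = i + e u v + (j + (r - 1) * (i + e u v))] (mod r)"
    unfolding t_def cong_add_lcancel_nat by simp
  also have "i + e u v + (j + (r - 1) * (i + e u v)) = j + r * (i + e u v)"
    using r0 by (cases r) (simp_all add: algebra_simps)
  also have "[j + r * (i + e u v) = j] (mod r)" by (simp add: cong_def)
  finally have ct: "[i + e u v + t = j] (mod r)" .
  have arc: "((u, i), (v, j)) \<in> parcs X \<longleftrightarrow> t = 0"
  proof -
    have "((u, i), (v, j)) \<in> parcs X \<longleftrightarrow> [i + e u v + 0 = i + e u v + t] (mod r)"
      using assms ct by (auto simp: arcs_iff intro: cong_trans cong_sym)
    also have "\<dots> \<longleftrightarrow> t = 0" unfolding cong_add_lcancel_nat using t by (simp add: cong_def)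
    finally show ?thesis .
  qed
  have iff: "[i + (e u w + e w v) = j] (mod r) \<longleftrightarrow> [e u w + e w v = e u v + t] (mod r)" for w
  proof -
    have "[i + (e u w + e w v) = j] (mod r) \<longleftrightarrow> [i + (e u w + e w v) = i + (e u v + t)] (mod r)"
      using ct by (metis add.assoc cong_sym cong_trans)
    then show ?thesis unfolding cong_add_lcancel_nat .
  qed
  let ?W = "{w. w < n \<and> w \<noteq> u \<and> w \<noteq> v \<and> [e u w + e w v = e u v + t] (mod r)}"
  have "{w \<in> pverts X. ((u, i), w) \<in> parcs X \<and> (w, (v, j)) \<in> parcs X} = (\<lambda>w. (w, rot r (e u w) i)) ` ?W"
  proof (intro subset_antisym subsetI)
    fix x assume "x \<in> {w \<in> pverts X. ((u, i), w) \<in> parcs X \<and> (w, (v, j)) \<in> parcs X}"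
    then obtain w l where x: "x = (w, l)" and w: "w < n" "w \<noteq> u" "w \<noteq> v" and l: "l \<in> {1..r}"
      and c1: "[i + e u w = l] (mod r)" and c2: "[l + e w v = j] (mod r)"
      by (cases x) (auto simp: arcs_iff)
    have "[i + e u w + e w v = l + e w v] (mod r)" using c1 by (simp only: cong_add_rcancel_nat)
    then have "[i + (e u w + e w v) = j] (mod r)" using c2 by (metis add.assoc cong_trans)
    then have "w \<in> ?W" using iff w by blast
    moreover have "rot r (e u w) i = l" using rot_eq_iff[OF assms(4) l] c1 by simp
    ultimately show "x \<in> (\<lambda>w. (w, rot r (e u w) i)) ` ?W" unfolding x by blast
  next
    fix x assume "x \<in> (\<lambda>w. (w, rot r (e u w) i)) ` ?W"
    then obtain w where x: "x = (w, rot r (e u w) i)" and w: "w < n" "w \<noteq> u" "w \<noteq> v"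
      and cw: "[e u w + e w v = e u v + t] (mod r)" by blast
    let ?l = "rot r (e u w) i"
    have l: "?l \<in> {1..r}" using assms(4) by (rule rot_mem)
    have c1: "[?l = i + e u w] (mod r)" using assms(4) by (rule rot_cong)
    then have "[?l + e w v = i + e u w + e w v] (mod r)" by (simp only: cong_add_rcancel_nat)
    moreover have "[i + (e u w + e w v) = j] (mod r)" using iff cw by blast
    ultimately have "[?l + e w v = j] (mod r)" by (metis add.assoc cong_trans)
    then show "x \<in> {w \<in> pverts X. ((u, i), w) \<in> parcs X \<and> (w, (v, j)) \<in> parcs X}"
      unfolding x using w l c1 assms by (simp add: arcs_iff verts cong_sym_eq)
  qed
  moreover have "inj_on (\<lambda>w. (w, rot r (e u w) i)) ?W" by (intro inj_onI) simp
  ultimately show ?thesis using count[OF assms(1-3) t] arc by (simp add: card_image)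
qed

sublocale drackn_graph X fst "{..<n}" r c k
proof (intro drackn_graph.intro fibred_graph.intro drackn_graph_axioms.intro)
  show "card {v \<in> pverts X. fst v = b} = r" if "b \<in> {..<n}" for b
  proof -
    have "{v \<in> pverts X. fst v = b} = {b} \<times> {1..r}" using that by (auto simp: verts)
    then show ?thesis by (simp add: card_cartesian_product)
  qed
  show "\<exists>!v. (u, v) \<in> parcs X \<and> fst v = b" if u: "u \<in> pverts X" "b \<in> {..<n}" "b \<noteq> fst u" for u b
  proof -
    obtain a i where a: "u = (a, i)" "a < n" "i \<in> {1..r}" using u(1) by (auto simp: verts)
    show ?thesis
    proof (intro ex1I conjI)
      show "(u, (b, rot r (e a b) i)) \<in> parcs X"
        using a u rot_mem[OF a(3), of "e a b"] rot_cong[OF a(3), of "e a b"] by (simp add: arcs_iff cong_sym_eq)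
      fix v assume v: "(u, v) \<in> parcs X \<and> fst v = b"
      then obtain j where j: "v = (b, j)" by (cases v) auto
      then have "rot r (e a b) i = j" using v a rot_eq_iff[of i r j "e a b"] by (simp add: arcs_iff)
      then show "v = (b, rot r (e a b) i)" using j by simp
    qed simp
  qed
  show "card {w \<in> pverts X. (u, w) \<in> parcs X \<and> (w, v) \<in> parcs X} = c"
    if "u \<in> pverts X" "v \<in> pverts X" "fst u \<noteq> fst v" "(u, v) \<notin> parcs X" for u v
    using common_neighbours[of "fst u" "fst v" "snd u" "snd v"] that by (auto simp: verts)
  show "card {w \<in> pverts X. (u, w) \<in> parcs X \<and> (w, v) \<in> parcs X} = k" if "(u, v) \<in> parcs X" for u v
    using common_neighbours[of "fst u" "fst v" "snd u" "snd v"] that by (cases u; cases v) (auto simp: arcs_iff)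
qed (use n r c pair_graph_X in \<open>auto simp: verts arcs_iff\<close>)

lemma fibres_eq: "fibres = arc_cover_fibres n r"
proof -
  have "{v \<in> pverts X. fst v = b} = {b} \<times> {1..r}" if "b < n" for b using that by (auto simp: verts)
  then show ?thesis unfolding fibres_def arc_cover_fibres_def by auto
qed

lemma normalized: "normalized_arc_function n r arcf"
proof -
  have af: "arcf u v \<in> carrier (sym_group r) \<and> arcf v u = inv\<^bsub>sym_group r\<^esub> (arcf u v)"
    if "(u, v) \<in> parcs (complete_graph n)" for u v
  proof -
    have uv: "u < n" "v < n" "u \<noteq> v" using that by (auto simp: complete_graph_def)
    show ?thesis
      by (intro conjI rot_carrier[OF r0] rot_inv[OF r0 skew[OF uv], symmetric])
  qed
  have "arc_function n r arcf"
    unfolding arc_function_def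
  proof
    fix x assume "x \<in> parcs (complete_graph n)"
    then show "case x of (u, v) \<Rightarrow> arcf u v \<in> carrier (sym_group r) \<and> arcf v u = inv\<^bsub>sym_group r\<^esub> (arcf u v)"
      using af by (cases x) (simp only: prod.case)
  qed
  moreover have "arcf u v = id" if "(u, v) \<in> parcs (star_graph n)" for u v
  proof -
    have uv: "u < n" "v < n" "u \<noteq> v" "u = 0 \<or> v = 0" using that by (auto simp: star_graph_def)
    have "r dvd e u v"
    proof (cases "u = 0")
      case True
      then show ?thesis using base uv by simp
    next
      case False
      then have "v = 0" "r dvd e v u" using base uv by auto
      then show ?thesis using skew[OF uv(1-3)] dvd_add_left_iff by blast
    qed
    then show ?thesis by (simp add: rot_eq_id_iff[OF r0])
  qed
  then have "\<forall>(u, v)\<in>parcs (star_graph n). arcf u v = id" by blast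
  moreover have "undirected_tree (star_graph n)" using n by (intro undirected_tree_star) simp
  ultimately show ?thesis
    unfolding normalized_arc_function_def using spanning_star by blast
qed

text \<open>Positivity of \<open>c\<close> yields a vertex \<open>w\<close> counted for the pair 0,
  1 at t = 1. Since row 0 is trivial, \<open>e w 1\<close> is 1 modulo r, so the shift by one, which
  generates all rotations, is a value of the arc function.\<close>

lemma arc_group: "arc_group n r arcf = (sym_group r)\<lparr>carrier := range (rot r)\<rparr>"
proof -
  let ?S = "{arcf u v | u v. (u, v) \<in> parcs (complete_graph n)}"
  have "card {w. w < n \<and> w \<noteq> 0 \<and> w \<noteq> 1 \<and> [e 0 w + e w 1 = e 0 1 + 1] (mod r)} = c"
    using count[of 0 1 1] n r by simp
  then have "{w. w < n \<and> w \<noteq> 0 \<and> w \<noteq> 1 \<and> [e 0 w + e w 1 = e 0 1 + 1] (mod r)} \<noteq> {}"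
    using c by (metis card.empty not_one_le_zero)
  then obtain w where w: "w < n" "w \<noteq> 0" "w \<noteq> 1" "[e 0 w + e w 1 = e 0 1 + 1] (mod r)" by blast
  have "[e 0 w = 0] (mod r)" "[e 0 1 = 0] (mod r)" using base w n by (auto simp: cong_0_iff)
  then have "[e 0 w + e w 1 = 0 + e w 1] (mod r)" "[e 0 1 + 1 = 0 + 1] (mod r)"
    by (simp_all only: cong_add_rcancel_nat)
  then have e1: "[e w 1 = 1] (mod r)" using w(4) by (metis add_0 cong_sym cong_trans)
  have "rot r (e w 1) = rot r 1"
  proof
    fix i
    show "rot r (e w 1) i = rot r 1 i"
    proof (cases "i \<in> {1..r}")
      case True
      have "[i + e w 1 = i + 1] (mod r)" using e1 by (simp only: cong_add_lcancel_nat)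
      also have "[i + 1 = rot r 1 i] (mod r)" using rot_cong[OF True] by (rule cong_sym)
      finally show ?thesis using rot_eq_iff[OF True rot_mem[OF True]] by blast
    qed (auto simp: rot_def)
  qed
  moreover have "(w, 1) \<in> parcs (complete_graph n)" using w n by (simp add: complete_graph_def)
  ultimately have "rot r 1 \<in> ?S" by (metis (mono_tags, lifting) mem_Collect_eq)
  then show ?thesis unfolding arc_group_def by (intro subgroup_generated_rot r0) auto
qed

lemma cyclic: "cyclic_group (arc_group n r arcf)"
proof -
  have "arc_group n r arcf = subgroup_generated (sym_group r) {rot r 1}"
    unfolding arc_group using subgroup_generated_rot[OF r0, of "{rot r 1}"] by simp
  then show ?thesis using group.cyclic_group_generated[OF sym_group_is_group] by metis
qed

theorem cyclic_drackn: "\<exists>X F. drackn n r c X F \<and> cyclic_cover n r X F"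
proof -
  have "drackn n r c X (arc_cover_fibres n r)" using drackn unfolding fibres_eq by simp
  moreover have "cyclic_cover n r X (arc_cover_fibres n r)"
    unfolding cyclic_cover_def
    using normalized acts_regularly_rot[OF r0] cyclic arc_group by metis
  ultimately show ?thesis by blast
qed

end

section \<open>The signature matrix\<close>

text \<open>For the frame operator \<open>T = \<Sum>\<^sub>i x\<^sub>i x\<^sub>i\<^sup>*\<close> the hypotheses say \<open>tr T = n\<close> and \<open>tr T\<^sup>2 = n\<^sup>2/d\<close>, so the
  Frobenius norm of \<open>T - (n/d) I\<close> is zero.\<close>

lemma tight_frame:
  fixes A :: "nat \<Rightarrow> nat \<Rightarrow> complex" and n d :: nat
  defines "g \<equiv> \<lambda>i j. \<Sum>p<d. A i p * cnj (A j p)"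
  assumes d: "0 < d" and unit: "\<And>i. i < n \<Longrightarrow> g i i = 1"
    and frame: "(\<Sum>i<n. \<Sum>j<n. (cmod (g i j))\<^sup>2) = (real n)\<^sup>2 / real d"
  shows "(\<Sum>k<n. g i k * g k j) = of_real (real n / real d) * g i j"
proof -
  define T where "T p q = (\<Sum>i<n. A i p * cnj (A i q))" for p q
  define b where "b = complex_of_real (real n / real d)"
  have cb: "cnj b = b" unfolding b_def by simp
  define D where "D p q = T p q - (if p = q then b else 0)" for p q
  \<comment> \<open>The frame operator and the Gram matrix have the same Frobenius norm; only the
    order of summation changes.\<close>
  have TT: "(\<Sum>p<d. \<Sum>q<d. T p q * cnj (T p q)) = of_real ((real n)\<^sup>2 / real d)"
  proof -
    have "(\<Sum>p<d. \<Sum>q<d. T p q * cnj (T p q)) =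
        (\<Sum>p<d. \<Sum>q<d. \<Sum>i<n. \<Sum>j<n. (A i p * cnj (A j p)) * (A j q * cnj (A i q)))"
      unfolding T_def by (simp add: sum_product mult_ac)
    also have "\<dots> = (\<Sum>p<d. \<Sum>i<n. \<Sum>q<d. \<Sum>j<n. (A i p * cnj (A j p)) * (A j q * cnj (A i q)))"
      by (rule sum.cong[OF refl], rule sum.swap)
    also have "\<dots> = (\<Sum>i<n. \<Sum>p<d. \<Sum>j<n. \<Sum>q<d. (A i p * cnj (A j p)) * (A j q * cnj (A i q)))"
      by (subst sum.swap) (rule sum.cong[OF refl], rule sum.cong[OF refl], rule sum.swap)
    also have "\<dots> = (\<Sum>i<n. \<Sum>j<n. \<Sum>p<d. \<Sum>q<d. (A i p * cnj (A j p)) * (A j q * cnj (A i q)))"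
      by (rule sum.cong[OF refl], rule sum.swap)
    also have "\<dots> = (\<Sum>i<n. \<Sum>j<n. g i j * cnj (g i j))"
      unfolding g_def by (simp add: sum_product mult_ac)
    also have "\<dots> = of_real (\<Sum>i<n. \<Sum>j<n. (cmod (g i j))\<^sup>2)"
      by (simp add: complex_norm_square del: of_real_power)
    finally show ?thesis unfolding frame .
  qed
  have tr: "(\<Sum>p<d. T p p) = of_nat n"
  proof -
    have "(\<Sum>p<d. T p p) = (\<Sum>i<n. g i i)" unfolding T_def g_def by (rule sum.swap)
    then show ?thesis using unit by simp
  qed
  then have ctr: "(\<Sum>p<d. cnj (T p p)) = of_nat n" by (metis cnj_sum complex_cnj_of_nat)
  have expand: "D p q * cnj (D p q) = T p q * cnj (T p q) -
      (if p = q then b * (T p p + cnj (T p p)) - b * b else 0)" for p q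
    unfolding D_def by (simp add: cb algebra_simps)
  have "(\<Sum>p<d. \<Sum>q<d. D p q * cnj (D p q)) =
      of_real ((real n)\<^sup>2 / real d) - (\<Sum>p<d. b * (T p p + cnj (T p p)) - b * b)"
    unfolding expand by (simp add: sum_subtractf TT)
  also have "(\<Sum>p<d. b * (T p p + cnj (T p p)) - b * b) = b * (of_nat n + of_nat n) - of_nat d * (b * b)"
    by (simp add: sum_subtractf sum.distrib sum_distrib_left[symmetric] tr ctr)
  also have "of_real ((real n)\<^sup>2 / real d) - \<dots> = 0"
    unfolding b_def using d by (simp add: field_simps power2_eq_square)
  finally have "complex_of_real (\<Sum>p<d. \<Sum>q<d. (cmod (D p q))\<^sup>2) = 0"
    by (simp add: complex_norm_square del: of_real_power)
  then have "(\<Sum>p<d. \<Sum>q<d. (cmod (D p q))\<^sup>2) = 0" by (simp only: of_real_eq_0_iff)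
  then have D0: "D p q = 0" if "p < d" "q < d" for p q
    using that by (simp add: sum_nonneg_eq_0_iff sum_nonneg)
  have Tpq: "T p q = (if p = q then b else 0)" if "p < d" "q < d" for p q
    using D0[OF that] unfolding D_def by simp
  \<comment> \<open>In matrix form G^2 = A T A* = b G, since T is b times the identity.\<close>
  have "(\<Sum>k<n. g i k * g k j) = (\<Sum>k<n. \<Sum>p<d. \<Sum>q<d. (A i p * cnj (A j q)) * (A k q * cnj (A k p)))"
    unfolding g_def sum_product by (intro sum.cong refl) (simp add: mult_ac)
  also have "\<dots> = (\<Sum>p<d. \<Sum>k<n. \<Sum>q<d. (A i p * cnj (A j q)) * (A k q * cnj (A k p)))"
    by (rule sum.swap)
  also have "\<dots> = (\<Sum>p<d. \<Sum>q<d. \<Sum>k<n. (A i p * cnj (A j q)) * (A k q * cnj (A k p)))"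
    by (rule sum.cong[OF refl], rule sum.swap)
  also have "\<dots> = (\<Sum>p<d. \<Sum>q<d. (A i p * cnj (A j q)) * T q p)"
    unfolding T_def by (simp add: sum_distrib_left)
  also have "\<dots> = (\<Sum>p<d. \<Sum>q<d. if q = p then (A i p * cnj (A j p)) * b else 0)"
    by (intro sum.cong refl) (auto simp: Tpq)
  also have "\<dots> = b * g i j" unfolding g_def by (simp add: sum_distrib_left mult_ac)
  finally show ?thesis unfolding b_def .
qed

section \<open>Unit vectors and the lines they span\<close>

lemma cscalar_prod_sum:
  assumes "u \<in> carrier_vec d" "v \<in> carrier_vec d"
  shows "u \<bullet>c v = (\<Sum>p<d. u $ p * cnj (v $ p))"
  using assms unfolding scalar_prod_def by (auto simp: lessThan_atLeast0 conjugate_complex_def intro!: sum.cong)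

lemma line_of_smult:
  assumes "z \<noteq> 0"
  shows "line_of (z \<cdot>\<^sub>v v) = line_of v"
proof -
  have "a \<cdot>\<^sub>v v = (a / z) \<cdot>\<^sub>v (z \<cdot>\<^sub>v v)" "a \<cdot>\<^sub>v (z \<cdot>\<^sub>v v) = (a * z) \<cdot>\<^sub>v v" for a
    using assms by (simp_all add: smult_smult_assoc)
  then show ?thesis unfolding line_of_def by blast
qed

text \<open>The equality case of Cauchy-Schwarz: if z is the inner product of \<open>u\<close> and
  \<open>v\<close>, the squared norm of u - z v is 1 - |z|^2 = 0.\<close>

lemma line_of_eqI:
  assumes uv: "u \<in> carrier_vec d" "v \<in> carrier_vec d"
    and unit: "u \<bullet>c u = 1" "v \<bullet>c v = 1" and "cmod (u \<bullet>c v) = 1"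
  shows "line_of u = line_of v"
proof -
  define z where "z = u \<bullet>c v"
  have z: "z = (\<Sum>p<d. u $ p * cnj (v $ p))" unfolding z_def using cscalar_prod_sum[OF uv] .
  have zz: "z * cnj z = 1" using assms(5) unfolding z_def by (simp add: complex_norm_square[symmetric])
  have cz: "cnj z = (\<Sum>p<d. v $ p * cnj (u $ p))" unfolding z by (simp add: mult.commute)
  have uu: "(\<Sum>p<d. u $ p * cnj (u $ p)) = 1" and vv: "(\<Sum>p<d. v $ p * cnj (v $ p)) = 1"
    using unit cscalar_prod_sum uv by metis+
  have "(\<Sum>p<d. (u $ p - z * v $ p) * cnj (u $ p - z * v $ p)) =
      (\<Sum>p<d. u $ p * cnj (u $ p)) - cnj z * (\<Sum>p<d. u $ p * cnj (v $ p)) -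
      z * (\<Sum>p<d. v $ p * cnj (u $ p)) + z * cnj z * (\<Sum>p<d. v $ p * cnj (v $ p))"
    by (simp add: sum_distrib_left sum_subtractf[symmetric] sum.distrib[symmetric] algebra_simps)
  also have "\<dots> = 0" unfolding uu vv z[symmetric] cz[symmetric] using zz by (simp add: mult.commute)
  finally have "complex_of_real (\<Sum>p<d. (cmod (u $ p - z * v $ p))\<^sup>2) = 0"
    by (simp add: complex_norm_square del: of_real_power complex_cnj_diff complex_cnj_mult)
  then have "(\<Sum>p<d. (cmod (u $ p - z * v $ p))\<^sup>2) = 0" by (simp only: of_real_eq_0_iff)
  then have "u $ p = z * v $ p" if "p < d" for p
    using that by (simp add: sum_nonneg_eq_0_iff)
  then have "u = z \<cdot>\<^sub>v v" using uv by (intro eq_vecI) auto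
  moreover have "z \<noteq> 0" using zz by auto
  ultimately show ?thesis using line_of_smult by simp
qed

lemma equiangular_angle_neq_1:
  assumes "equiangular_lines n d \<alpha> x"
  shows "\<alpha> \<noteq> 1"
proof
  assume "\<alpha> = 1"
  moreover have "0 < n" "1 < n" using assms unfolding equiangular_lines_def by auto
  ultimately have line: "line_of (x 0) = line_of (x 1)"
    using assms unfolding equiangular_lines_def by (intro line_of_eqI[of _ d]) auto
  have "inj_on (\<lambda>i. line_of (x i)) {..<n}"
    using assms unfolding equiangular_lines_def by blast
  from inj_onD[OF this line] \<open>0 < n\<close> \<open>1 < n\<close> show False by simp
qed

text \<open>A constant \<open>g\<close> gives the total number of elements; powers of a root of
  unity give the character sum.\<close>

lemma sum_card_fibres:
  fixes g :: "nat \<Rightarrow> 'a :: comm_semiring_1"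
  assumes "finite A" "\<And>w. w \<in> A \<Longrightarrow> \<tau> w < r"
  shows "(\<Sum>t<r. of_nat (card {w \<in> A. \<tau> w = t}) * g t) = (\<Sum>w\<in>A. g (\<tau> w))"
proof -
  have "(\<Sum>t<r. of_nat (card {w \<in> A. \<tau> w = t}) * g t) = (\<Sum>t<r. \<Sum>w\<in>{w \<in> A. \<tau> w = t}. g (\<tau> w))"
    by (intro sum.cong refl) simp
  also have "\<dots> = (\<Sum>w\<in>A. g (\<tau> w))" using assms by (intro sum.group) auto
  finally show ?thesis .
qed

lemma root_of_unity_power:
  assumes "0 < r" "z ^ r = (1 :: complex)"
  shows "\<exists>k. z = cis (2 * pi / real r) ^ k"
proof -
  have "z \<in> (\<lambda>k. cis (2 * pi * real k / real r)) ` {..<r}"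
    using bij_betw_roots_unity[OF assms(1)] assms(2) unfolding bij_betw_def by auto
  then show ?thesis by (auto simp: DeMoivre mult_ac)
qed

lemma cis_root: "0 < r \<Longrightarrow> cis (2 * pi / real r) ^ r = 1"
  by (simp add: DeMoivre)

lemma cis_root_neq_1:
  assumes "1 < r"
  shows "cis (2 * pi / real r) \<noteq> 1"
proof
  assume "cis (2 * pi / real r) = 1"
  moreover have "inj_on (\<lambda>k. cis (2 * pi * real k / real r)) {..<r}"
    using bij_betw_roots_unity[of r] assms unfolding bij_betw_def by simp
  ultimately show False using inj_onD[of "\<lambda>k. cis (2 * pi * real k / real r)" "{..<r}" 1 0] assms by simp
qed

text \<open>The off-diagonal part of the quadratic equation for S. The square of the Gram matrix is
  n/d times itself, the terms with k = i and k = j each contribute the entry once, and division by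
  \<alpha>^2 turns n/d - 2 into the coefficient.\<close>

lemma relative_bound_signature:
  assumes lines: "equiangular_lines n d \<alpha> x" and \<alpha>: "\<alpha> > 0" and d: "0 < d"
    and bound: "\<alpha>\<^sup>2 = (real n - real d) / ((real n - 1) * real d)"
    and ij: "i < n" "j < n" "i \<noteq> j"
  shows "(\<Sum>k\<in>{..<n} - {i, j}. signature_matrix n \<alpha> x $$ (i, k) * signature_matrix n \<alpha> x $$ (k, j)) =
    of_real ((real n - 2 * real d) / (\<alpha> * real d)) * signature_matrix n \<alpha> x $$ (i, j)"
proof -
  have n: "2 \<le> n" and vec: "\<And>i. i < n \<Longrightarrow> x i \<in> carrier_vec d"
    and unit: "\<And>i. i < n \<Longrightarrow> x i \<bullet>c x i = 1"
    and angle: "\<And>i j. i < n \<Longrightarrow> j < n \<Longrightarrow> i \<noteq> j \<Longrightarrow> cmod (x i \<bullet>c x j) = \<alpha>"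
    using lines unfolding equiangular_lines_def by auto
  define g where "g i j = (\<Sum>p<d. x i $ p * cnj (x j $ p))" for i j
  have g: "g i j = x i \<bullet>c x j" if "i < n" "j < n" for i j
    unfolding g_def using cscalar_prod_sum vec that by metis
  have sig: "signature_matrix n \<alpha> x $$ (i, j) = g i j / of_real \<alpha>" if "i < n" "j < n" "i \<noteq> j" for i j
    using that g unfolding signature_matrix_def gram_matrix_def by simp
  \<comment> \<open>The row sum is 1 + (n - 1) \<alpha>^2; the relative bound makes it n /
    d.\<close>
  have "(\<Sum>j<n. (cmod (g i j))\<^sup>2) = real n / real d" if i: "i < n" for i
  proof -
    have "(\<Sum>j<n. (cmod (g i j))\<^sup>2) = (cmod (g i i))\<^sup>2 + (\<Sum>j\<in>{..<n} - {i}. (cmod (g i j))\<^sup>2)"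
      using i by (intro sum.remove) auto
    also have "(\<Sum>j\<in>{..<n} - {i}. (cmod (g i j))\<^sup>2) = (\<Sum>j\<in>{..<n} - {i}. \<alpha>\<^sup>2)"
      using i by (intro sum.cong) (auto simp: g angle)
    also have "\<dots> = (real n - 1) * \<alpha>\<^sup>2" using i n by (simp add: of_nat_diff)
    also have "(cmod (g i i))\<^sup>2 + (real n - 1) * \<alpha>\<^sup>2 = real n / real d"
      unfolding bound using n d i by (simp add: g unit field_simps)
    finally show ?thesis .
  qed
  then have frame: "(\<Sum>i<n. \<Sum>j<n. (cmod (g i j))\<^sup>2) = (real n)\<^sup>2 / real d"
    by (simp add: power2_eq_square)
  have "(\<Sum>k<n. g i k * g k j) = of_real (real n / real d) * g i j"
    using tight_frame[of d n "\<lambda>i p. x i $ p" i j] d frame g unit unfolding g_def by auto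
  moreover have "(\<Sum>k<n. g i k * g k j) = g i i * g i j + (g i j * g j j + (\<Sum>k\<in>{..<n} - {i} - {j}. g i k * g k j))"
    using ij by (subst sum.remove[of _ i], simp, simp, subst sum.remove[of _ j], auto)
  moreover have "g i i = 1" "g j j = 1" using g unit ij by auto
  ultimately have off: "(\<Sum>k\<in>{..<n} - {i, j}. g i k * g k j) = of_real (real n / real d - 2) * g i j"
    by (simp add: Diff_insert2[symmetric] algebra_simps)
  have "(\<Sum>k\<in>{..<n} - {i, j}. signature_matrix n \<alpha> x $$ (i, k) * signature_matrix n \<alpha> x $$ (k, j)) =
      (\<Sum>k\<in>{..<n} - {i, j}. (g i k * g k j) / (of_real \<alpha> * of_real \<alpha>))"
    using ij by (intro sum.cong) (auto simp: sig)
  also have "\<dots> = of_real (real n / real d - 2) * g i j / (of_real \<alpha> * of_real \<alpha>)"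
    unfolding sum_divide_distrib[symmetric] off ..
  also have "\<dots> = of_real ((real n - 2 * real d) / (\<alpha> * real d)) * signature_matrix n \<alpha> x $$ (i, j)"
    unfolding sig[OF ij] using \<alpha> d by (simp add: field_simps)
  finally show ?thesis .
qed

lemma signature_matrix_hermitian:
  assumes "equiangular_lines n d \<alpha> x" "i < n" "j < n"
  shows "signature_matrix n \<alpha> x $$ (j, i) = cnj (signature_matrix n \<alpha> x $$ (i, j))"
proof -
  have "x i \<in> carrier_vec d" "x j \<in> carrier_vec d"
    using assms unfolding equiangular_lines_def by auto
  then have "x j \<bullet>c x i = cnj (x i \<bullet>c x j)"
    by (simp add: cscalar_prod_sum mult.commute)
  then show ?thesis using assms(2,3) unfolding signature_matrix_def gram_matrix_def by simp
qed

theorem theorem5p1: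
  fixes n d r :: nat and \<alpha> :: real and x :: "nat \<Rightarrow> complex vec"
  assumes "equiangular_lines n d \<alpha> x"
    and "\<alpha> > 0"
    and "\<alpha>\<^sup>2 = (real n - real d) / ((real n - 1) * real d)"
    and "prime r"
    and "\<forall>i<n. \<forall>j<n. i \<noteq> j \<longrightarrow> (signature_matrix n \<alpha> x $$ (i, j)) ^ r = 1"
  shows "\<exists>c :: nat.
     real c = 1 / real r * ((real n - 2) + (2 * real d - real n) / (\<alpha> * real d)) \<and>
     (\<exists>X F. drackn n r c X F \<and> cyclic_cover n r X F)"
proof -
  note bound = assms(3)
  have n: "2 \<le> n" using assms(1) unfolding equiangular_lines_def by simp
  have \<alpha>2: "\<alpha>\<^sup>2 > 0" using assms(2) by simp
  \<comment> \<open>For d = 0 the quotient in the bound is 0 by the convention for division by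
    zero.\<close>
  have d: "0 < d" using \<alpha>2 bound by (cases d) auto
  have r1: "1 < r" using assms(4) prime_gt_1_nat by blast
  have bound': "\<alpha>\<^sup>2 * ((real n - 1) * real d) = real n - real d"
    unfolding bound using n d by simp
  have "\<alpha>\<^sup>2 * ((real n - 1) * real d) > 0" using \<alpha>2 n d by simp
  then have dn: "real d < real n" unfolding bound' by simp
  define a where "a = (real n - 2 * real d) / (\<alpha> * real d)"
  have a\<alpha>: "a * (\<alpha> * real d) = real n - 2 * real d" unfolding a_def using assms(2) d by simp

  define \<zeta> where "\<zeta> = cis (2 * pi / real r)"
  have \<zeta>: "\<zeta> ^ r = 1" "\<zeta> \<noteq> 1"
    unfolding \<zeta>_def using cis_root cis_root_neq_1 r1 by simp_all
  define S where "S i j = signature_matrix n \<alpha> x $$ (i, j)" for i j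
  have Sr: "S i j ^ r = 1" if "i < n" "j < n" "i \<noteq> j" for i j
    using assms(5) that unfolding S_def by blast
  have Sc: "S j i = cnj (S i j)" if "i < n" "j < n" for i j
    unfolding S_def using signature_matrix_hermitian[OF assms(1) that] .
  have unitary: "z * cnj z = 1" if "z ^ r = 1" for z :: complex
    using root_of_unity_mult_cnj[OF _ that] r1 by simp
  \<comment> \<open>Rescaling the vectors makes row \<open>0\<close> of the signature matrix constant, which normalizes the arc function.\<close>
  define h where "h i = (if i = 0 then 1 else S 0 i)" for i
  have hr: "h i ^ r = 1" if "i < n" for i unfolding h_def using Sr[of 0 i] that n by auto
  \<comment> \<open>This conjugates S by a diagonal unitary matrix of r-th roots of unity, which
    preserves the quadratic equation.\<close>
  define W where "W i j = h i * S i j * cnj (h j)" for i j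
  have Wr: "W i j ^ r = 1" if "i < n" "j < n" "i \<noteq> j" for i j
  proof -
    have "cnj (h j) ^ r = 1" using hr[OF that(2)] by (metis complex_cnj_one complex_cnj_power)
    then show ?thesis unfolding W_def using hr Sr that by (simp add: power_mult_distrib)
  qed
  have Wc: "W j i = cnj (W i j)" if "i < n" "j < n" for i j
    unfolding W_def using Sc[OF that] by (simp add: mult_ac)
  have W0: "W 0 j = 1" if "0 < j" "j < n" for j
    using unitary[OF Sr[of 0 j]] that by (simp add: W_def h_def)
  have Wsum: "(\<Sum>k\<in>{..<n} - {i, j}. W i k * W k j) = of_real a * W i j" if ij: "i < n" "j < n" "i \<noteq> j" for i j
  proof -
    have "(\<Sum>k\<in>{..<n} - {i, j}. W i k * W k j) =
        (\<Sum>k\<in>{..<n} - {i, j}. h i * cnj (h j) * (S i k * S k j))"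
    proof (rule sum.cong[OF refl])
      fix k assume "k \<in> {..<n} - {i, j}"
      then have hh: "h k * cnj (h k) = 1" using unitary[OF hr] by simp
      have "W i k * W k j = (h k * cnj (h k)) * (h i * cnj (h j) * (S i k * S k j))"
        unfolding W_def by (simp only: mult_ac)
      then show "W i k * W k j = h i * cnj (h j) * (S i k * S k j)" unfolding hh by simp
    qed
    also have "\<dots> = h i * cnj (h j) * (of_real a * S i j)"
      unfolding sum_distrib_left[symmetric] S_def a_def
      using relative_bound_signature[OF assms(1,2) d bound ij] by simp
    finally show ?thesis unfolding W_def by (simp add: mult_ac)
  qed

  \<comment> \<open>On the diagonal \<open>W\<close> is zero and the chosen exponent is arbitrary;
    the counts leave out \<open>w = u\<close> and \<open>w = v\<close>.\<close>
  define e where "e i j = (SOME k. W i j = \<zeta> ^ k)" for i j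
  have e: "W i j = \<zeta> ^ e i j" if "i < n" "j < n" "i \<noteq> j" for i j
    unfolding e_def using root_of_unity_power[OF _ Wr[OF that]] r1
    by (intro someI_ex[of "\<lambda>k. W i j = \<zeta> ^ k"]) (simp add: \<zeta>_def)
  have skew: "r dvd e u v + e v u" if uv: "u < n" "v < n" "u \<noteq> v" for u v
  proof -
    have "\<zeta> ^ (e u v + e v u) = W u v * cnj (W u v)"
      unfolding power_add using e[OF uv] e[of v u] uv Wc[OF uv(1,2)] by simp
    then have "\<zeta> ^ (e u v + e v u) = 1" using unitary[OF Wr[OF uv]] by simp
    then show ?thesis using root_power_eq_iff[OF assms(4) \<zeta>] by blast
  qed
  have base: "r dvd e 0 v" if "0 < v" "v < n" for v
    using W0[OF that] e[of 0 v] that root_power_eq_iff[OF assms(4) \<zeta>] by simp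

  define N where "N u v t = card {w. w < n \<and> w \<noteq> u \<and> w \<noteq> v \<and> [e u w + e w v = e u v + t] (mod r)}" for u v t
  have N: "(\<Sum>t<r. N u v t) = n - 2" "(\<Sum>t<r. of_nat (N u v t) * \<zeta> ^ t) = of_real a"
    if uv: "u < n" "v < n" "u \<noteq> v" for u v
  proof -
    let ?A = "{..<n} - {u, v}"
    \<comment> \<open>The residue of \<open>e u w + e w v\<close> minus
      \<open>e u v\<close>.\<close>
    define \<tau> where "\<tau> w = (e u w + e w v + (r - 1) * e u v) mod r" for w
    have \<tau>_less: "\<tau> w < r" for w unfolding \<tau>_def using r1 by simp
    have iff: "[e u w + e w v = e u v + t] (mod r) \<longleftrightarrow> \<tau> w = t" if "t < r" for w t
    proof -
      have "e u v + (r - 1) * e u v = r * e u v" using r1 by (cases r) auto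
      then have eq: "e u v + (e u w + e w v + (r - 1) * e u v) = e u w + e w v + r * e u v" by simp
      have "[e u v + \<tau> w = e u v + (e u w + e w v + (r - 1) * e u v)] (mod r)"
        unfolding \<tau>_def cong_add_lcancel_nat by (simp add: cong_def)
      then have "[e u v + \<tau> w = e u w + e w v] (mod r)" unfolding eq by (simp add: cong_def)
      then have "[e u w + e w v = e u v + t] (mod r) \<longleftrightarrow> [e u v + \<tau> w = e u v + t] (mod r)"
        by (meson cong_sym cong_trans)
      also have "\<dots> \<longleftrightarrow> \<tau> w = t" unfolding cong_add_lcancel_nat using that \<tau>_less by (simp add: cong_def)
      finally show ?thesis .
    qed
    have N\<tau>: "N u v t = card {w \<in> ?A. \<tau> w = t}" if "t < r" for t
      unfolding N_def using iff[OF that] by (intro arg_cong[of _ _ card]) auto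
    have "(\<Sum>t<r. N u v t) = (\<Sum>t<r. of_nat (card {w \<in> ?A. \<tau> w = t}) * 1)"
      by (intro sum.cong) (auto simp: N\<tau>)
    also have "\<dots> = (\<Sum>w\<in>?A. 1)" by (rule sum_card_fibres) (auto simp: \<tau>_less)
    also have "\<dots> = n - 2" using uv by (simp add: card_Diff_subset)
    finally show "(\<Sum>t<r. N u v t) = n - 2" .
    have "(\<Sum>t<r. of_nat (N u v t) * \<zeta> ^ t) = (\<Sum>t<r. of_nat (card {w \<in> ?A. \<tau> w = t}) * \<zeta> ^ t)"
      by (intro sum.cong) (auto simp: N\<tau>)
    also have "\<dots> = (\<Sum>w\<in>?A. \<zeta> ^ \<tau> w)" by (rule sum_card_fibres) (auto simp: \<tau>_less)
    also have "\<dots> = (\<Sum>w\<in>?A. W u w * W w v * cnj (W u v))"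
    proof (rule sum.cong[OF refl])
      fix w assume w: "w \<in> ?A"
      have per: "\<zeta> ^ (m mod r) = \<zeta> ^ m" for m
      proof -
        have "\<zeta> ^ m = \<zeta> ^ (r * (m div r) + m mod r)" by simp
        also have "\<dots> = \<zeta> ^ (m mod r)" unfolding power_add power_mult using \<zeta>(1) by simp
        finally show ?thesis by simp
      qed
      have inv: "\<zeta> ^ ((r - 1) * e u v) = cnj (W u v)"
      proof -
        have eq: "e u v + (r - 1) * e u v = r * e u v" using r1 by (cases r) auto
        have "W u v * \<zeta> ^ ((r - 1) * e u v) = \<zeta> ^ (r * e u v)"
          unfolding e[OF uv] power_add[symmetric] eq ..
        also have "\<dots> = 1" unfolding power_mult \<zeta>(1) by simp
        finally have "cnj (W u v) = cnj (W u v) * (W u v * \<zeta> ^ ((r - 1) * e u v))" by simp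
        also have "\<dots> = (W u v * cnj (W u v)) * \<zeta> ^ ((r - 1) * e u v)" by (simp only: mult_ac)
        finally have "cnj (W u v) = (W u v * cnj (W u v)) * \<zeta> ^ ((r - 1) * e u v)" .
        then show ?thesis using unitary[OF Wr[OF uv]] by simp
      qed
      have "\<zeta> ^ \<tau> w = \<zeta> ^ e u w * \<zeta> ^ e w v * \<zeta> ^ ((r - 1) * e u v)"
        unfolding \<tau>_def per power_add ..
      also have "\<dots> = W u w * W w v * cnj (W u v)"
        unfolding inv using e[of u w] e[of w v] w uv by auto
      finally show "\<zeta> ^ \<tau> w = W u w * W w v * cnj (W u v)" .
    qed
    also have "\<dots> = of_real a * (W u v * cnj (W u v))"
      unfolding sum_distrib_right[symmetric] Wsum[OF uv] by (simp add: mult.assoc)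
    also have "\<dots> = of_real a" using unitary[OF Wr[OF uv]] by simp
    finally show "(\<Sum>t<r. of_nat (N u v t) * \<zeta> ^ t) = of_real a" .
  qed

  \<comment> \<open>Rationality of a^2 and the eigenvalue identity\<close>
  define D where "D = real d * (real n - real d)"
  have D0: "D > 0" unfolding D_def using d dn by simp
  have a2: "a\<^sup>2 * D = (real n - 2 * real d)\<^sup>2 * (real n - 1)"
  proof -
    have "(a * (\<alpha> * real d))\<^sup>2 * (real n - 1) = a\<^sup>2 * real d * (\<alpha>\<^sup>2 * ((real n - 1) * real d))"
      by (simp add: power2_eq_square algebra_simps)
    then show ?thesis unfolding a\<alpha> bound' D_def by (simp add: mult_ac)
  qed
  have count: "real r * real (N u v t) = real (n - 2) - a"
    if uv: "u < n" "v < n" "u \<noteq> v" and t: "0 < t" "t < r" for u v t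
  \<comment> \<open>Here u / v is a^2, while \<open>k\<close> and \<open>l\<close> are the sum and
    the difference of the eigenvalues of S, both multiplied by \<alpha> d.\<close>
  proof (rule root_sum_coeffs_equal[OF assms(4) \<zeta> N(2)[OF uv] N(1)[OF uv], where
        u = "(int n - 2 * int d)\<^sup>2 * (int n - 1)" and v = "int d * (int n - int d)" and
        k = "int n - 2 * int d" and l = "int n"])
    show "a\<^sup>2 * real_of_int (int d * (int n - int d)) = real_of_int ((int n - 2 * int d)\<^sup>2 * (int n - 1))"
      using a2 unfolding D_def by simp
    show "int d * (int n - int d) \<noteq> 0" using d dn by simp
    have id: "(real n - 2 * real d)\<^sup>2 + 4 * D = (real n)\<^sup>2"
      unfolding D_def by (simp add: power2_eq_square algebra_simps)
    have "(a\<^sup>2 + 4 * (real n - 1)) * (real n - 2 * real d)\<^sup>2 * D = 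
        (a\<^sup>2 * D + 4 * D * (real n - 1)) * (real n - 2 * real d)\<^sup>2"
      by (simp add: algebra_simps)
    also have "\<dots> = ((real n - 2 * real d)\<^sup>2 + 4 * D) * ((real n - 2 * real d)\<^sup>2 * (real n - 1))"
      unfolding a2 by (simp add: algebra_simps)
    also have "\<dots> = a\<^sup>2 * (real n)\<^sup>2 * D" unfolding id a2[symmetric] by (simp add: mult_ac)
    finally have "(a\<^sup>2 + 4 * (real n - 1)) * (real n - 2 * real d)\<^sup>2 = a\<^sup>2 * (real n)\<^sup>2"
      using D0 by simp
    then show "(a\<^sup>2 + 4 * (real (n - 2) + 1)) * real_of_int ((int n - 2 * int d)\<^sup>2) = a\<^sup>2 * real_of_int ((int n)\<^sup>2)"
      using n by (simp add: of_nat_diff)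
    show "int n \<noteq> 0" using n by simp
  qed (use t in auto)

  define c where "c = N 0 1 1"
  define k where "k = N 0 1 0"
  have rc: "real r * real c = real (n - 2) - a"
    unfolding c_def using count[of 0 1 1] n r1 by simp
  have Nc: "N u v t = c" if "u < n" "v < n" "u \<noteq> v" "0 < t" "t < r" for u v t
  proof -
    have "real r * real (N u v t) = real r * real c" using count[OF that] rc by simp
    then show ?thesis using r1 by simp
  qed
  \<comment> \<open>The counts of a pair add up to n - 2 and those with t > 0 equal
    \<open>c\<close>, so the remaining one is independent of the pair as well.\<close>
  have Nk: "N u v 0 = k" if uv: "u < n" "v < n" "u \<noteq> v" for u v
  proof -
    have split: "{..<r} = insert 0 {1..<r}" using r1 by force
    have "N u v 0 + (\<Sum>t\<in>{1..<r}. c) = n - 2" if uv: "u < n" "v < n" "u \<noteq> v" for u v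
    proof -
      have "(\<Sum>t\<in>{1..<r}. N u v t) = (\<Sum>t\<in>{1..<r}. c)"
        using Nc[OF uv] by (intro sum.cong) auto
      then show ?thesis using N(1)[OF uv] unfolding split by simp
    qed
    from this[OF uv] this[of 0 1] show ?thesis unfolding k_def using n by simp
  qed
  have c_pos: "1 \<le> c"
  proof (rule ccontr)
    assume "\<not> 1 \<le> c"
    then have "c = 0" by simp
    \<comment> \<open>the roots of \<open>t\<^sup>2 - (n - 2) t - (n - 1)\<close> are \<open>n - 1\<close> and \<open>-1\<close>, and \<open>-1/\<alpha>\<close> is one of them\<close>
    then have "a = real n - 2" using rc n by simp
    then have "(real n - 2) * (\<alpha> * real d) = real n - 2 * real d" using a\<alpha> by simp
    then have "real d * ((1 - \<alpha>) * (1 + (real n - 1) * \<alpha>)) = 0"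
      using bound' by (simp add: algebra_simps power2_eq_square)
    moreover have "1 + (real n - 1) * \<alpha> > 0" using n assms(2) by (simp add: add_pos_nonneg)
    ultimately have "\<alpha> = 1" using d by simp
    then show False using equiangular_angle_neq_1[OF assms(1)] by simp
  qed
  interpret exponent_matrix n r c k e
  proof
    fix u v t assume "u < n" "v < n" "u \<noteq> v" "t < r"
    then show "card {w. w < n \<and> w \<noteq> u \<and> w \<noteq> v \<and> [e u w + e w v = e u v + t] (mod r)} = (if t = 0 then k else c)"
      using Nk[of u v] Nc[of u v t] unfolding N_def by simp
  qed (use n r1 c_pos skew base in auto)
  have "real c = 1 / real r * ((real n - 2) + (2 * real d - real n) / (\<alpha> * real d))"
  proof -
    have "real r * real c = (real n - 2) + (2 * real d - real n) / (\<alpha> * real d)"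
      unfolding rc a_def using n by (simp add: of_nat_diff diff_divide_distrib)
    then show ?thesis using r1 by (simp add: field_simps)
  qed
  then show ?thesis using cyclic_drackn by blast
qed

end
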